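(* For every $\varepsilon>0$ and $\delta>0$ there exist states $\rho_0,\rho_1$ on a finite-dimensional bipartite system $AB$ with $P_{\mathrm{opt}}(\rho_0,\rho_1)=1$ (i.e. $\rho_0$ and $\rho_1$ are orthogonal) such that $$P_{\mathrm{LOCC}}(\rho_0,\rho_1)<\tfrac12+\varepsilon\quad\text{and}\quad R_{\mathrm m}(\rho_0,\rho_1)>1-\delta.$$
   Context: All systems are finite-dimensional. $P_{\mathrm{opt}}(\rho_0,\rho_1)=\tfrac12+\tfrac14\|\rho_0-\rho_1\|_1$. LOCC denotes local operations and classical communication between Alice (systems $A,A'$) and Bob (systems $B,B'$). An LOCC measurement channel is $\mathcal M(X)=\sum_i\mathrm{Tr}[M_iX]|ii\rangle\langle ii|$ with $\{M_i\}$ an LOCC-implementable POVM; $\|X\|_{\mathrm{LOCC}}=\sup_{\mathcal M}\|\mathcal M(X)\|_1$; $P_{\mathrm{LOCC}}(\rho_0,\rho_1)=\tfrac12+\tfrac14\|\rho_0-\rho_1\|_{\mathrm{LOCC}}$. Repeated discrimination framework: $Z_j$ i.i.d. uniform on $\{0,1\}$; in round $j$ the state $\rho_{Z_j}$ is given, the guess is $Y_j$, $X_j=1$ iff $Y_j=Z_j$, $S_n=\sum_{j\le n}X_j$. A rate $r$ is achievable if for all $\varepsilon>0$, $m>0$ there is $n\ge m$ with $\Pr(S_n\ge rn)\ge1-\varepsilon$. Memory-assisted protocols: a finite-dimensional shared memory $A'B'$ with initial state $\mu_1^{A'B'}$; in round $j$ an LOCC protocol (allowed to depend on all classical outcomes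 of earlier rounds, but not on the $Z$'s) is applied to $\rho^{AB}_{Z_j}\otimes\mu_j^{A'B'}$, producing $Y_j$ and an outcome-dependent memory state $\mu_{j+1}^{A'B'}$ passed to the next round. $R_{\mathrm m}(\rho_0,\rho_1)$ is the supremum of achievable rates over all memory dimensions, initial memory states and such protocols. *)

theory Defs
  imports "Jordan_Normal_Form.Char_Poly"
begin

text \<open>Index convention for composite systems: on a tensor product of a system of
dimension d1 with one of dimension d2, basis index (i1, i2) is encoded as i1 * d2 + i2.\<close>

definition cadj :: "complex mat \<Rightarrow> complex mat" where
  "cadj X = mat (dim_col X) (dim_row X) (\<lambda>(i,j). cnj (X $$ (j,i)))"

definition mtrace :: "complex mat \<Rightarrow> complex" where
  "mtrace X = (\<Sum>i<dim_row X. X $$ (i,i))"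

definition kron :: "complex mat \<Rightarrow> complex mat \<Rightarrow> complex mat" where
  "kron X Y = mat (dim_row X * dim_row Y) (dim_col X * dim_col Y)
     (\<lambda>(i,j). X $$ (i div dim_row Y, j div dim_col Y) * Y $$ (i mod dim_row Y, j mod dim_col Y))"

definition psd :: "complex mat \<Rightarrow> bool" where
  "psd X \<longleftrightarrow> dim_row X = dim_col X \<and> cadj X = X \<and>
     (\<forall>v \<in> carrier_vec (dim_row X).
        Im (conjugate v \<bullet> (X *\<^sub>v v)) = 0 \<and> Re (conjugate v \<bullet> (X *\<^sub>v v)) \<ge> 0)"

definition density :: "nat \<Rightarrow> complex mat \<Rightarrow> bool" where
  "density n \<rho> \<longleftrightarrow> \<rho> \<in> carrier_mat n n \<and> psd \<rho> \<and> mtrace \<rho> = 1"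

definition trace_norm :: "complex mat \<Rightarrow> real" where
  "trace_norm X =
     (let p = char_poly (cadj X * X) in
      \<Sum>e\<in>{e. poly p e = 0}. real (order e p) * sqrt (cmod e))"

definition P_opt :: "complex mat \<Rightarrow> complex mat \<Rightarrow> real" where
  "P_opt \<rho>0 \<rho>1 = 1/2 + 1/4 * trace_norm (\<rho>0 - \<rho>1)"

text \<open>locc a b af bf L: L is the list of leaves of a finite-round LOCC protocol
(one party applies a local instrument, broadcasts the outcome, and the protocol
continues depending on it).  The protocol starts on Alice dimension a and Bob
dimension b and ends on Alice dimension af and Bob dimension bf.  Each leaf is a pair
(K, lab) of the accumulated (product of local) Kraus operators K, an (af*bf) x (a*b)
matrix, and a classical output label o.  Local Kraus operators may change the local
dimension (ancillas, discarding subsystems).\<close>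

inductive locc :: "nat \<Rightarrow> nat \<Rightarrow> nat \<Rightarrow> nat \<Rightarrow> (complex mat \<times> 'o) list \<Rightarrow> bool" where
  leaf: "locc a b a b [(1\<^sub>m (a * b), lab)]"
| alice: "\<lbrakk> list_all (\<lambda>(A, L). dim_col A = a \<and> locc (dim_row A) b af bf L) ps;
           foldr (\<lambda>(A, L) S. cadj A * A + S) ps (0\<^sub>m a a) = 1\<^sub>m a \<rbrakk>
   \<Longrightarrow> locc a b af bf (concat (map (\<lambda>(A, L). map (\<lambda>(K, lab). (K * kron A (1\<^sub>m b), lab)) L) ps))"
| bob: "\<lbrakk> list_all (\<lambda>(B, L). dim_col B = b \<and> locc a (dim_row B) af bf L) ps;
           foldr (\<lambda>(B, L) S. cadj B * B + S) ps (0\<^sub>m b b) = 1\<^sub>m b \<rbrakk>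
   \<Longrightarrow> locc a b af bf (concat (map (\<lambda>(B, L). map (\<lambda>(K, lab). (K * kron (1\<^sub>m a) B, lab)) L) ps))"

definition povm_el :: "nat \<Rightarrow> (complex mat \<times> nat) list \<Rightarrow> nat \<Rightarrow> complex mat" where
  "povm_el d L i = foldr (\<lambda>(K, lab) S. (if lab = i then cadj K * K else 0\<^sub>m d d) + S) L (0\<^sub>m d d)"

definition locc_meas :: "nat \<Rightarrow> nat \<Rightarrow> nat \<Rightarrow> (complex mat \<times> nat) list \<Rightarrow> bool" where
  "locc_meas dA dB N L \<longleftrightarrow> (\<exists>af bf. locc dA dB af bf L) \<and> list_all (\<lambda>(K, lab). lab < N) L"

text \<open>Measurement channel M(X) = sum_i Tr[M_i X] |ii><ii|, written as the diagonal
matrix on the span of the |ii> (isometric image, same trace norm).\<close>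
definition meas_channel :: "nat \<Rightarrow> nat \<Rightarrow> nat \<Rightarrow> (complex mat \<times> nat) list \<Rightarrow> complex mat \<Rightarrow> complex mat" where
  "meas_channel dA dB N L X =
     mat N N (\<lambda>(i,j). if i = j then mtrace (povm_el (dA * dB) L i * X) else 0)"

definition locc_norm :: "nat \<Rightarrow> nat \<Rightarrow> complex mat \<Rightarrow> real" where
  "locc_norm dA dB X = Sup {trace_norm (meas_channel dA dB N L X) | N L. locc_meas dA dB N L}"

definition P_LOCC :: "nat \<Rightarrow> nat \<Rightarrow> complex mat \<Rightarrow> complex mat \<Rightarrow> real" where
  "P_LOCC dA dB \<rho>0 \<rho>1 = 1/2 + 1/4 * locc_norm dA dB (\<rho>0 - \<rho>1)"

text \<open>Given X on AB (dims dA, dB) and Y on A'B' (dims dA', dB'), the operator X \<otimes> Y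
on (A A') (B B'), i.e. with Alice's system A A' (index a * dA' + a') and Bob's system
B B' (index b * dB' + b').\<close>
definition combine :: "nat \<Rightarrow> nat \<Rightarrow> nat \<Rightarrow> nat \<Rightarrow> complex mat \<Rightarrow> complex mat \<Rightarrow> complex mat" where
  "combine dA dB dA' dB' X Y =
     mat ((dA * dA') * (dB * dB')) ((dA * dA') * (dB * dB'))
       (\<lambda>(i,j).
          let ia = i div (dB * dB'); ib = i mod (dB * dB');
              ja = j div (dB * dB'); jb = j mod (dB * dB')
          in X $$ ((ia div dA') * dB + ib div dB', (ja div dA') * dB + jb div dB') *
             Y $$ ((ia mod dA') * dB' + ib mod dB', (ja mod dA') * dB' + jb mod dB'))"

text \<open>A memory-assisted protocol: memory dimensions dA', dB', initial memory state mu1 and,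
for each classical history h (list of the indices of the leaves reached in the previous
rounds), an LOCC protocol on (A A')(B B') ending on A'B', whose leaves carry the guess
(False = 0, True = 1).\<close>
definition mem_protocol ::
  "nat \<Rightarrow> nat \<Rightarrow> nat \<Rightarrow> nat \<Rightarrow> complex mat \<Rightarrow> (nat list \<Rightarrow> (complex mat \<times> bool) list) \<Rightarrow> bool" where
  "mem_protocol dA dB dA' dB' \<mu>1 P \<longleftrightarrow>
     density (dA' * dB') \<mu>1 \<and> (\<forall>h. locc (dA * dA') (dB * dB') dA' dB' (P h))"

text \<open>run ... n h sigma f: for the remaining n rounds, starting with classical history h and
(unnormalised) memory state sigma, the sum over all Z-values and leaf sequences of
probability weight times f(number of correct guesses in these n rounds).  Z_j is uniform
on {0,1} (False = 0, True = 1).\<close>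
fun run :: "nat \<Rightarrow> nat \<Rightarrow> nat \<Rightarrow> nat \<Rightarrow> complex mat \<Rightarrow> complex mat \<Rightarrow>
    (nat list \<Rightarrow> (complex mat \<times> bool) list) \<Rightarrow> nat \<Rightarrow> nat list \<Rightarrow> complex mat \<Rightarrow> (nat \<Rightarrow> real) \<Rightarrow> real" where
  "run dA dB dA' dB' \<rho>0 \<rho>1 P 0 h \<sigma> f = Re (mtrace \<sigma>) * f 0"
| "run dA dB dA' dB' \<rho>0 \<rho>1 P (Suc n) h \<sigma> f =
     (\<Sum>z\<in>{False, True}. 1/2 *
        (\<Sum>i<length (P h).
           run dA dB dA' dB' \<rho>0 \<rho>1 P n (h @ [i])
             (fst (P h ! i) * combine dA dB dA' dB' (if z then \<rho>1 else \<rho>0) \<sigma> * cadj (fst (P h ! i)))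
             (\<lambda>s. f (s + (if snd (P h ! i) = z then 1 else 0)))))"

definition prob_rate :: "nat \<Rightarrow> nat \<Rightarrow> nat \<Rightarrow> nat \<Rightarrow> complex mat \<Rightarrow> complex mat \<Rightarrow> complex mat \<Rightarrow>
    (nat list \<Rightarrow> (complex mat \<times> bool) list) \<Rightarrow> nat \<Rightarrow> real \<Rightarrow> real" where
  "prob_rate dA dB dA' dB' \<rho>0 \<rho>1 \<mu>1 P n r =
     run dA dB dA' dB' \<rho>0 \<rho>1 P n [] \<mu>1 (\<lambda>s. if real s \<ge> r * real n then 1 else 0)"

definition achievable :: "nat \<Rightarrow> nat \<Rightarrow> nat \<Rightarrow> nat \<Rightarrow> complex mat \<Rightarrow> complex mat \<Rightarrow> complex mat \<Rightarrow>
    (nat list \<Rightarrow> (complex mat \<times> bool) list) \<Rightarrow> real \<Rightarrow> bool" where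
  "achievable dA dB dA' dB' \<rho>0 \<rho>1 \<mu>1 P r \<longleftrightarrow>
     (\<forall>\<epsilon>>0. \<forall>m::nat. m > 0 \<longrightarrow>
        (\<exists>n\<ge>m. prob_rate dA dB dA' dB' \<rho>0 \<rho>1 \<mu>1 P n r \<ge> 1 - \<epsilon>))"

definition R_m :: "nat \<Rightarrow> nat \<Rightarrow> complex mat \<Rightarrow> complex mat \<Rightarrow> real" where
  "R_m dA dB \<rho>0 \<rho>1 = Sup {r. \<exists>dA' dB' \<mu>1 P. mem_protocol dA dB dA' dB' \<mu>1 P \<and>
                                   achievable dA dB dA' dB' \<rho>0 \<rho>1 \<mu>1 P r}"

end

theory Submission
  imports Defs "Jordan_Normal_Form.Schur_Decomposition"
begin

text \<open>With probability \<open>p\<close> (small, so that locally it helps little) the state carries a fresh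
maximally entangled pair of local dimension \<open>d ^ K\<close> together with a visible copy of the bit; otherwise
it hides the bit in a pair of Werner states on \<open>d \<times> d\<close> (symmetric versus antisymmetric), which LOCC
cannot tell apart because a product effect has nonnegative overlap with the swap operator. The memory
holds a maximally entangled state of dimension \<open>d ^ c\<close>. A hidden round teleports Alice's part to Bob,
who measures the swap; this spends one factor \<open>d\<close> and lowers \<open>c\<close> by one. A round with a
fresh pair resets \<open>c\<close> to \<open>K\<close>. Errors occur only while \<open>c = 0\<close>, and an exponential Lyapunov
function shows that for large \<open>K\<close> their fraction is below any prescribed level, with probability
tending to one. The protocol does not even look at the history: measuring with exhausted memory just returns
exhausted memory.\<close>

section \<open>Matrix entries and mixtures of pure states\<close>

text \<open>Two parameters act independently. The parameter \<open>p\<close> alone controls how much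
  the fresh-pair branch helps a local measurement: at most \<open>2 * p\<close> in LOCC norm,
  whatever the size of the pair. So \<open>K\<close> stays free and is chosen last. The counter
  reaches zero only after \<open>K\<close> hidden rounds without a fresh pair, an event of order
  \<open>(1 - p) ^ K\<close>. A refill overwrites the old memory instead of adding to it: left-over
  entanglement is wasted, but the memory dimension stays bounded. The obstacle is the adaptive
  quantum run, whose memory state could depend on the whole history in a complicated way. The Kraus
  operators are therefore taken so fine that, after a given outcome, every component of the mixture
  leaves the same pure memory vector, up to a scalar. A round then acts on a pair (weight, counter),
  and the run becomes a classical Markov chain. An achievable rate demands concentration, not just a
  good average. Correct guesses in different rounds are correlated through the counter, so an
  exponential moment is bounded along the chain and Markov's inequality is applied.\<close>

lemma mult_mat_entry:
  assumes "A \<in> carrier_mat n m" "B \<in> carrier_mat m l" "i < n" "j < l"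
  shows "(A * B) $$ (i,j) = (\<Sum>k<m. A $$ (i,k) * B $$ (k,j))"
  using assms by (auto simp: scalar_prod_def atLeast0LessThan intro!: sum.cong)

lemma cadj_carrier [simp]: "A \<in> carrier_mat n m \<Longrightarrow> cadj A \<in> carrier_mat m n"
  by (auto simp: cadj_def)

lemma cadj_entry: "A \<in> carrier_mat n m \<Longrightarrow> i < m \<Longrightarrow> j < n \<Longrightarrow> cadj A $$ (i,j) = cnj (A $$ (j,i))"
  by (auto simp: cadj_def)

lemma cadj_mult_entry:
  assumes "A \<in> carrier_mat n m" "i < m" "j < m"
  shows "(cadj A * A) $$ (i,j) = (\<Sum>k<n. cnj (A $$ (k,i)) * A $$ (k,j))"
  using assms by (subst mult_mat_entry[where n=m and m=n and l=m]) (auto simp: cadj_entry)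

lemma sandwich_entry:
  assumes K: "K \<in> carrier_mat r n" and X: "X \<in> carrier_mat n n" and "i < r" "j < r"
  shows "(K * X * cadj K) $$ (i,j) = (\<Sum>k<n. \<Sum>l<n. K $$ (i,k) * X $$ (k,l) * cnj (K $$ (j,l)))"
proof -
  have "(K * X * cadj K) $$ (i,j) = (\<Sum>l<n. (\<Sum>k<n. K $$ (i,k) * X $$ (k,l)) * cnj (K $$ (j,l)))"
    using assms by (subst mult_mat_entry[where n=r and m=n and l=r])
      (auto simp: cadj_entry mult_mat_entry[OF K X] simp del: index_mult_mat intro!: sum.cong)
  thus ?thesis by (simp add: sum_distrib_right) (rule sum.swap)
qed

lemma sandwich_carrier: "K \<in> carrier_mat r n \<Longrightarrow> X \<in> carrier_mat n n \<Longrightarrow> K * X * cadj K \<in> carrier_mat r r"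
  by (auto simp: cadj_def)

lemma mtrace_carrier: "A \<in> carrier_mat n n \<Longrightarrow> mtrace A = (\<Sum>i<n. A $$ (i,i))"
  by (auto simp: mtrace_def)

lemma mtrace_sandwich:
  assumes K: "K \<in> carrier_mat r n" and X: "X \<in> carrier_mat n n"
  shows "mtrace (K * X * cadj K) = (\<Sum>i<r. \<Sum>k<n. \<Sum>l<n. K $$ (i,k) * X $$ (k,l) * cnj (K $$ (i,l)))"
  using sandwich_entry[OF assms] sandwich_carrier[OF assms] unfolding mtrace_def
  by (auto simp del: index_mult_mat intro!: sum.cong)

lemma mtrace_gram_mult:
  assumes K: "K \<in> carrier_mat r n" and X: "X \<in> carrier_mat n n"
  shows "mtrace (cadj K * K * X) = mtrace (K * X * cadj K)"
proof -
  have G: "cadj K * K \<in> carrier_mat n n" using K by (auto simp: cadj_def)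
  have "mtrace (cadj K * K * X) = (\<Sum>l<n. \<Sum>k<n. (\<Sum>i<r. cnj (K $$ (i,l)) * K $$ (i,k)) * X $$ (k,l))"
    unfolding mtrace_carrier[OF mult_carrier_mat[OF G X]]
    by (simp add: mult_mat_entry[OF G X] cadj_mult_entry[OF K] del: index_mult_mat)
  also have "\<dots> = (\<Sum>l<n. \<Sum>k<n. \<Sum>i<r. K $$ (i,k) * X $$ (k,l) * cnj (K $$ (i,l)))"
    by (simp add: sum_distrib_left sum_distrib_right mult_ac)
  also have "\<dots> = (\<Sum>i<r. \<Sum>k<n. \<Sum>l<n. K $$ (i,k) * X $$ (k,l) * cnj (K $$ (i,l)))"
  proof -
    have "(\<Sum>l<n. \<Sum>k<n. \<Sum>i<r. K $$ (i,k) * X $$ (k,l) * cnj (K $$ (i,l)))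
      = (\<Sum>l<n. \<Sum>i<r. \<Sum>k<n. K $$ (i,k) * X $$ (k,l) * cnj (K $$ (i,l)))"
      by (rule sum.cong[OF refl], rule sum.swap)
    also have "\<dots> = (\<Sum>i<r. \<Sum>l<n. \<Sum>k<n. K $$ (i,k) * X $$ (k,l) * cnj (K $$ (i,l)))"
      by (rule sum.swap)
    also have "\<dots> = (\<Sum>i<r. \<Sum>k<n. \<Sum>l<n. K $$ (i,k) * X $$ (k,l) * cnj (K $$ (i,l)))"
      by (rule sum.cong[OF refl], rule sum.swap)
    finally show ?thesis .
  qed
  finally show ?thesis using mtrace_sandwich[OF assms] by simp
qed

lemma sum_mult_index:
  fixes f :: "nat \<Rightarrow> 'a::comm_monoid_add"
  shows "(\<Sum>i<n*m. f i) = (\<Sum>a<n. \<Sum>b<m. f (a*m+b))"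
proof -
  have "(\<Sum>a<n. \<Sum>b<m. f (a*m+b)) = (\<Sum>a<n. sum f {a*m..<a*m+m})"
  proof (rule sum.cong[OF refl])
    fix a
    show "(\<Sum>b<m. f (a*m+b)) = sum f {a*m..<a*m+m}"
      by (rule sum.reindex_bij_witness[of _ "\<lambda>i. i - a * m" "\<lambda>b. a * m + b"]) auto
  qed
  thus ?thesis by (simp add: sum.nat_group)
qed

lemma pair_index_less: "(a::nat) < n \<Longrightarrow> b < m \<Longrightarrow> a * m + b < n * m"
proof -
  assume "a < n" "b < m"
  hence "a * m + b < Suc a * m" "Suc a * m \<le> n * m" by (auto simp del: mult_Suc intro: mult_le_mono1) simp_all
  thus ?thesis by (rule less_le_trans)
qed

text \<open>A decomposition into rank-one terms, kept so that a Kraus operator only has to be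
  applied to vectors. Weights stay apart from the vectors because signed weights occur later, in the
  operator that bounds the LOCC norm.\<close>

definition mix :: "nat \<Rightarrow> 'k set \<Rightarrow> ('k \<Rightarrow> real) \<Rightarrow> ('k \<Rightarrow> nat \<Rightarrow> complex) \<Rightarrow> complex mat" where
  "mix n S w u = mat n n (\<lambda>(i,j). \<Sum>k\<in>S. of_real (w k) * u k i * cnj (u k j))"

lemma mix_carrier [simp]: "mix n S w u \<in> carrier_mat n n"
  by (simp add: mix_def)

lemma mix_dim [simp]: "dim_row (mix n S w u) = n" "dim_col (mix n S w u) = n"
  by (simp_all add: mix_def)

lemma mix_entry: "i < n \<Longrightarrow> j < n \<Longrightarrow> mix n S w u $$ (i,j) = (\<Sum>k\<in>S. of_real (w k) * u k i * cnj (u k j))"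
  by (simp add: mix_def)

lemma mtrace_mix: "mtrace (mix n S w u) = of_real (\<Sum>k\<in>S. w k * (\<Sum>i<n. (cmod (u k i))\<^sup>2))"
proof -
  have "mtrace (mix n S w u) = (\<Sum>k\<in>S. \<Sum>i<n. of_real (w k) * u k i * cnj (u k i))"
    unfolding mtrace_def by (subst sum.swap) (auto simp: mix_entry)
  thus ?thesis by (simp add: sum_distrib_left mult.assoc complex_norm_square del: of_real_power)
qed

lemma mix_sandwich:
  assumes K: "K \<in> carrier_mat r n"
  shows "K * mix n S w u * cadj K = mix r S w (\<lambda>k i. \<Sum>j<n. K $$ (i,j) * u k j)"
proof (rule eq_matI)
  fix i j assume "i < dim_row (mix r S w (\<lambda>k i. \<Sum>j<n. K $$ (i,j) * u k j))"
    "j < dim_col (mix r S w (\<lambda>k i. \<Sum>j<n. K $$ (i,j) * u k j))"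
  hence ij: "i < r" "j < r" by auto
  have "(K * mix n S w u * cadj K) $$ (i,j)
      = (\<Sum>a<n. \<Sum>b<n. \<Sum>k\<in>S. of_real (w k) * (K $$ (i,a) * u k a) * (cnj (K $$ (j,b)) * cnj (u k b)))"
    unfolding sandwich_entry[OF K mix_carrier ij]
    by (auto simp: mix_entry sum_distrib_left sum_distrib_right mult_ac intro!: sum.cong)
  also have "\<dots> = (\<Sum>k\<in>S. \<Sum>a<n. \<Sum>b<n. of_real (w k) * (K $$ (i,a) * u k a) * (cnj (K $$ (j,b)) * cnj (u k b)))"
    by (subst (2) sum.swap, subst sum.swap) (rule refl)
  also have "\<dots> = mix r S w (\<lambda>k i. \<Sum>j<n. K $$ (i,j) * u k j) $$ (i,j)"
    using ij by (auto simp: mix_entry sum_distrib_left sum_distrib_right mult_ac intro!: sum.cong)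
  finally show "(K * mix n S w u * cadj K) $$ (i,j) = mix r S w (\<lambda>k i. \<Sum>j<n. K $$ (i,j) * u k j) $$ (i,j)" .
qed (use K in \<open>auto simp: cadj_def\<close>)

lemma psd_mix:
  assumes w: "\<And>k. k \<in> S \<Longrightarrow> 0 \<le> w k"
  shows "psd (mix n S w u)"
proof -
  have 1: "cadj (mix n S w u) = mix n S w u"
    by (rule eq_matI) (auto simp: cadj_def mix_entry intro!: sum.cong)
  have 2: "conjugate v \<bullet> (mix n S w u *\<^sub>v v) = of_real (\<Sum>k\<in>S. w k * (cmod (\<Sum>i<n. cnj (v $ i) * u k i))\<^sup>2)"
    if v: "v \<in> carrier_vec n" for v
  proof -
    have "conjugate v \<bullet> (mix n S w u *\<^sub>v v)
        = (\<Sum>i<n. \<Sum>j<n. \<Sum>k\<in>S. of_real (w k) * (cnj (v $ i) * u k i) * (v $ j * cnj (u k j)))"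
      using v by (auto simp: scalar_prod_def mix_entry atLeast0LessThan sum_distrib_left sum_distrib_right mult_ac
          intro!: sum.cong)
    also have "\<dots> = (\<Sum>k\<in>S. \<Sum>i<n. \<Sum>j<n. of_real (w k) * (cnj (v $ i) * u k i) * (v $ j * cnj (u k j)))"
      by (subst (2) sum.swap, subst sum.swap) (rule refl)
    also have "\<dots> = (\<Sum>k\<in>S. of_real (w k) * ((\<Sum>i<n. cnj (v $ i) * u k i) * cnj (\<Sum>i<n. cnj (v $ i) * u k i)))"
      by (auto simp: sum_distrib_left sum_distrib_right mult_ac intro!: sum.cong)
    finally show ?thesis by (simp add: complex_norm_square del: of_real_power)
  qed
  show ?thesis unfolding psd_def using 1 w by (auto simp: 2 intro!: sum_nonneg)
qed

lemma mix_orthogonal: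
  assumes "\<And>k l. k \<in> S \<Longrightarrow> l \<in> T \<Longrightarrow> (\<Sum>i<n. cnj (u k i) * v l i) = 0"
  shows "mix n S w u * mix n T w' v = 0\<^sub>m n n"
proof (rule eq_matI)
  fix i j assume "i < dim_row (0\<^sub>m n n :: complex mat)" "j < dim_col (0\<^sub>m n n :: complex mat)"
  hence ij: "i < n" "j < n" by auto
  have "(mix n S w u * mix n T w' v) $$ (i,j)
      = (\<Sum>a<n. \<Sum>k\<in>S. \<Sum>l\<in>T. (of_real (w k) * u k i * of_real (w' l) * cnj (v l j)) * (cnj (u k a) * v l a))"
    unfolding mult_mat_entry[OF mix_carrier mix_carrier ij] using ij
    by (auto simp: mix_entry sum_product mult_ac intro!: sum.cong)
  also have "\<dots> = (\<Sum>k\<in>S. \<Sum>l\<in>T. \<Sum>a<n. (of_real (w k) * u k i * of_real (w' l) * cnj (v l j)) * (cnj (u k a) * v l a))"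
    by (subst sum.swap, subst (2) sum.swap) (rule refl)
  also have "\<dots> = (\<Sum>k\<in>S. \<Sum>l\<in>T. (of_real (w k) * u k i * of_real (w' l) * cnj (v l j)) * (\<Sum>a<n. cnj (u k a) * v l a))"
    by (simp add: sum_distrib_left)
  also have "\<dots> = 0" using assms by simp
  finally show "(mix n S w u * mix n T w' v) $$ (i,j) = 0\<^sub>m n n $$ (i,j)" using ij by simp
qed auto

text \<open>Parallel vectors span one line, so the mixture is a multiple of a single projector. This
  is what keeps the memory pure from round to round.\<close>

lemma mix_collapse:
  assumes "\<And>k i. k \<in> S \<Longrightarrow> i < n \<Longrightarrow> u k i = c k * v i"
  shows "mix n S w u = mix n {()} (\<lambda>_. \<Sum>k\<in>S. w k * (cmod (c k))\<^sup>2) (\<lambda>_. v)"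
proof (rule eq_matI)
  fix i j assume "i < dim_row (mix n {()} (\<lambda>_. \<Sum>k\<in>S. w k * (cmod (c k))\<^sup>2) (\<lambda>_. v))"
    "j < dim_col (mix n {()} (\<lambda>_. \<Sum>k\<in>S. w k * (cmod (c k))\<^sup>2) (\<lambda>_. v))"
  thus "mix n S w u $$ (i,j) = mix n {()} (\<lambda>_. \<Sum>k\<in>S. w k * (cmod (c k))\<^sup>2) (\<lambda>_. v) $$ (i,j)"
    using assms by (auto simp: mix_entry sum_distrib_left sum_distrib_right complex_norm_square mult_ac
        simp del: of_real_power intro!: sum.cong)
qed auto

lemma combine_mix:
  "combine dA dB dA' dB' (mix (dA * dB) S w u) (mix (dA' * dB') {()} (\<lambda>_. w0) (\<lambda>_. v)) =
   mix ((dA * dA') * (dB * dB')) S (\<lambda>k. w k * w0)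
     (\<lambda>k i. u k ((i div (dB * dB')) div dA' * dB + (i mod (dB * dB')) div dB')
          * v ((i div (dB * dB')) mod dA' * dB' + (i mod (dB * dB')) mod dB'))"
proof (rule eq_matI; (simp add: combine_def)?)
  fix i j assume ij: "i < dA * dA' * (dB * dB')" "j < dA * dA' * (dB * dB')"
  have pos: "0 < dA'" "0 < dB'" "0 < dB" using ij by (auto intro!: Nat.gr0I)
  have b: "(i div (dB * dB')) div dA' * dB + (i mod (dB * dB')) div dB' < dA * dB"
     "(i div (dB * dB')) mod dA' * dB' + (i mod (dB * dB')) mod dB' < dA' * dB'"
    if "i < dA * dA' * (dB * dB')" for i
  proof -
    have "i div (dB * dB') < dA * dA'" using that by (simp add: less_mult_imp_div_less)
    moreover have "i mod (dB * dB') < dB * dB'" using pos by simp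
    ultimately show "(i div (dB * dB')) div dA' * dB + (i mod (dB * dB')) div dB' < dA * dB"
     "(i div (dB * dB')) mod dA' * dB' + (i mod (dB * dB')) mod dB' < dA' * dB'"
      using pos by (auto intro!: pair_index_less simp: less_mult_imp_div_less)
  qed
  show "(let ia = i div (dB * dB'); ib = i mod (dB * dB'); ja = j div (dB * dB'); jb = j mod (dB * dB')
         in mix (dA * dB) S w u $$ (ia div dA' * dB + ib div dB', ja div dA' * dB + jb div dB') *
            mix (dA' * dB') {()} (\<lambda>_. w0) (\<lambda>_. v) $$ (ia mod dA' * dB' + ib mod dB', ja mod dA' * dB' + jb mod dB')) =
        mix (dA * dA' * (dB * dB')) S (\<lambda>k. w k * w0)
         (\<lambda>k i. u k (i div (dB * dB') div dA' * dB + i mod (dB * dB') div dB')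
              * v (i div (dB * dB') mod dA' * dB' + i mod (dB * dB') mod dB')) $$ (i, j)"
    unfolding Let_def
    by (simp only: mix_entry b[OF ij(1)] b[OF ij(2)] ij)
      (simp add: sum_distrib_left sum_distrib_right mult_ac)
qed

section \<open>Trace norm\<close>

text \<open>The multiplicity of a root of a split polynomial is its number of occurrences in the
  list of linear factors. This turns the sum in \<open>trace_norm\<close> into a sum over a list of
  eigenvalues.\<close>

lemma sum_roots_order:
  fixes f :: "complex \<Rightarrow> real"
  shows "(\<Sum>e\<in>{e. poly (\<Prod>a\<leftarrow>es. [:- a, 1:]) e = 0}. real (Polynomial.order e (\<Prod>a\<leftarrow>es. [:- a, 1:])) * f e)
    = (\<Sum>e\<leftarrow>es. f e)"
proof -
  let ?p = "\<lambda>es. (\<Prod>a\<leftarrow>es. [:- a, 1:]) :: complex poly"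
  have nz: "?p es \<noteq> 0" for es by auto
  have ord: "Polynomial.order e (?p es) = count_list es e" for e es
  proof (induction es)
    case (Cons a es)
    have nz2: "[:- a, 1:] * ?p es \<noteq> 0" using nz[of "a # es"] by simp
    have "Polynomial.order e [:- a, 1:] = (if e = a then 1 else 0)"
      by (auto simp: order_linear' intro!: order_0I)
    thus ?case using order_mult[OF nz2, of e] Cons by simp
  qed (auto intro!: order_0I)
  have roots: "{e. poly (?p es) e = 0} = set es" by (induction es) auto
  have count: "(\<Sum>e\<leftarrow>xs. f e) = (\<Sum>e\<in>A. real (count_list xs e) * f e)"
    if "finite A" "set xs \<subseteq> A" for xs A using that
  proof (induction xs)
    case (Cons a xs)
    have "(\<Sum>e\<in>A. real (count_list (a # xs) e) * f e)
        = (\<Sum>e\<in>A. (if e = a then f a else 0) + real (count_list xs e) * f e)"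
      by (intro sum.cong refl) (auto simp: algebra_simps)
    thus ?case using Cons by (simp add: sum.distrib)
  qed simp
  have "(\<Sum>e\<leftarrow>es. f e) = (\<Sum>e\<in>set es. real (count_list es e) * f e)"
    by (rule count) auto
  thus ?thesis by (simp only: ord roots)
qed

lemma trace_norm_of_roots:
  assumes "char_poly (cadj X * X) = (\<Prod>a\<leftarrow>es. [:- a, 1:])"
  shows "trace_norm X = (\<Sum>e\<leftarrow>es. sqrt (cmod e))"
  unfolding trace_norm_def Let_def assms by (rule sum_roots_order)

lemma trace_norm_diag:
  "trace_norm (mat N N (\<lambda>(i,j). if i = j then f i else 0)) = (\<Sum>i<N. cmod (f i))"
proof -
  define X where "X = mat N N (\<lambda>(i,j). if i = j then f i else 0)"
  have X: "X \<in> carrier_mat N N" by (simp add: X_def)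
  have G: "cadj X * X \<in> carrier_mat N N" using X by (auto simp: cadj_def)
  have e: "(cadj X * X) $$ (i,j) = (if i = j then of_real ((cmod (f i))\<^sup>2) else 0)" if "i < N" "j < N" for i j
  proof -
    have "(cadj X * X) $$ (i,j) = (\<Sum>k<N. if k = i then (if i = j then cnj (f i) * f i else 0) else 0)"
      unfolding cadj_mult_entry[OF X that] using that by (intro sum.cong) (auto simp: X_def)
    also have "\<dots> = (if i = j then cnj (f i) * f i else 0)" using that by simp
    finally show ?thesis by (simp add: complex_norm_square mult.commute del: of_real_power)
  qed
  have "upper_triangular (cadj X * X)"
    using G e by (intro upper_triangularI) auto
  hence "char_poly (cadj X * X) = (\<Prod>a\<leftarrow>diag_mat (cadj X * X). [:- a, 1:])"
    by (rule char_poly_upper_triangular[OF G])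
  moreover have "diag_mat (cadj X * X) = map (\<lambda>i. of_real ((cmod (f i))\<^sup>2)) [0..<N]"
    unfolding diag_mat_def using G e by (auto simp del: index_mult_mat(1))
  ultimately have "trace_norm X = (\<Sum>e\<leftarrow>map (\<lambda>i. complex_of_real ((cmod (f i))\<^sup>2)) [0..<N]. sqrt (cmod e))"
    by (intro trace_norm_of_roots) (simp only:)
  also have "\<dots> = (\<Sum>i<N. cmod (f i))"
    by (simp add: comp_def interv_sum_list_conv_sum_set_nat atLeast0LessThan norm_power del: of_real_power)
  finally show ?thesis unfolding X_def .
qed

lemma mtrace_mult_commute:
  assumes "A \<in> carrier_mat n m" "B \<in> carrier_mat m n"
  shows "mtrace (A * B) = mtrace (B * A)"
proof -
  have "mtrace (A * B) = (\<Sum>i<n. \<Sum>k<m. A $$ (i,k) * B $$ (k,i))"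
    unfolding mtrace_carrier[OF mult_carrier_mat[OF assms]]
    by (simp add: mult_mat_entry[OF assms] del: index_mult_mat)
  also have "\<dots> = (\<Sum>k<m. \<Sum>i<n. B $$ (k,i) * A $$ (i,k))"
    by (subst sum.swap) (simp add: mult.commute)
  also have "\<dots> = mtrace (B * A)"
    unfolding mtrace_carrier[OF mult_carrier_mat[OF assms(2,1)]]
    by (simp add: mult_mat_entry[OF assms(2,1)] del: index_mult_mat)
  finally show ?thesis .
qed

text \<open>The quadratic form at an eigenvector is the eigenvalue times a positive squared norm,
  hence the eigenvalue is real and nonnegative.\<close>

lemma psd_eigenvalue:
  assumes P: "P \<in> carrier_mat n n" "psd P" and ev: "eigenvalue P e"
  shows "e = of_real (cmod e)"
proof -
  from ev P(1) obtain v where v: "v \<in> carrier_vec n" "v \<noteq> 0\<^sub>v n" "P *\<^sub>v v = e \<cdot>\<^sub>v v"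
    unfolding eigenvalue_def eigenvector_def by auto
  define q where "q = conjugate v \<bullet> (P *\<^sub>v v)"
  define N where "N = (\<Sum>i<n. (cmod (v $ i))\<^sup>2)"
  have "Im q = 0" "Re q \<ge> 0" using P v unfolding psd_def q_def by auto
  have "conjugate v \<bullet> v = of_real N"
    using v unfolding N_def by (auto simp: scalar_prod_def atLeast0LessThan complex_norm_square mult.commute
       simp del: of_real_power intro!: sum.cong)
  hence q: "q = e * of_real N" using v unfolding q_def v(3) by simp
  from v(1,2) obtain i where "i < n" "v $ i \<noteq> 0"
    by (metis carrier_vecD eq_vecI index_zero_vec)
  hence N: "N > 0" unfolding N_def by (intro sum_pos2[of _ i]) auto
  have "Im e * N = 0" "Re e * N \<ge> 0" using \<open>Im q = 0\<close> \<open>Re q \<ge> 0\<close> unfolding q by auto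
  hence "Im e = 0" "Re e \<ge> 0" using N by (auto simp: zero_le_mult_iff)
  thus ?thesis by (auto simp: complex_eq_iff cmod_def)
qed

text \<open>Here \<open>P\<close> plays the role of the absolute value of \<open>X\<close>, so no
  operator square root has to be constructed. Schur triangularisation of \<open>P\<close> gives
  \<open>B\<close>; the squared diagonal entries of \<open>B\<close> are the roots belonging to
  \<open>P * P\<close>, and the entries themselves are nonnegative because they are eigenvalues of
  \<open>P\<close>.\<close>

lemma trace_norm_psd_square:
  assumes P: "P \<in> carrier_mat n n" "psd P" and X: "cadj X * X = P * P"
  shows "of_real (trace_norm X) = mtrace P"
proof -
  from char_poly_factorized[OF P(1)] obtain es where es: "char_poly P = (\<Prod>a\<leftarrow>es. [:- a, 1:])" by auto
  from schur_decomposition_exists[OF P(1) es] obtain B where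
    B: "B \<in> carrier_mat n n" "upper_triangular B" "similar_mat P B" by auto
  then obtain S T where ST: "similar_mat_wit P B S T" unfolding similar_mat_def by auto
  note w = similar_mat_witD2[OF P(1) ST]
  have "P * P = S * (B * B) * T"
  proof -
    have "P * P = (S * B * T) * (S * B * T)" using w by simp
    also have "\<dots> = S * B * (T * S) * (B * T)" using w(4-7)
      by (simp add: assoc_mult_mat[of _ n n _ n _ n])
    also have "\<dots> = S * B * (B * T)" using w by simp
    also have "\<dots> = S * (B * B) * T" using w(4-7) by (simp add: assoc_mult_mat[of _ n n _ n _ n])
    finally show ?thesis .
  qed
  hence "similar_mat_wit (P * P) (B * B) S T"
    using w by (intro similar_mat_witI[where n=n]) auto
  hence "char_poly (P * P) = char_poly (B * B)"
    by (intro char_poly_similar) (auto simp: similar_mat_def)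
  have BB: "B * B \<in> carrier_mat n n" using B by auto
  have tri: "B $$ (i,j) = 0" if "j < i" "i < n" for i j using B that by auto
  have e: "(B * B) $$ (i,j) = (if i = j then B $$ (i,i) * B $$ (i,i) else 0)" if "j \<le> i" "i < n" for i j
  proof -
    have "(B * B) $$ (i,j) = (\<Sum>k<n. if k = i then (if i = j then B $$ (i,i) * B $$ (i,i) else 0) else 0)"
    proof (subst mult_mat_entry[OF B(1) B(1)])
      show "(\<Sum>k<n. B $$ (i,k) * B $$ (k,j)) = (\<Sum>k<n. if k = i then (if i = j then B $$ (i,i) * B $$ (i,i) else 0) else 0)"
      proof (intro sum.cong refl)
        fix k assume "k \<in> {..<n}"
        thus "B $$ (i,k) * B $$ (k,j) = (if k = i then (if i = j then B $$ (i,i) * B $$ (i,i) else 0) else 0)"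
          using that tri[of k i] tri[of j k] by (cases k i rule: linorder_cases) auto
      qed
    qed (use that in auto)
    thus ?thesis using that by simp
  qed
  have "upper_triangular (B * B)" using BB e by (intro upper_triangularI) (auto simp del: index_mult_mat(1))
  hence "char_poly (B * B) = (\<Prod>a\<leftarrow>diag_mat (B * B). [:- a, 1:])"
    by (rule char_poly_upper_triangular[OF BB])
  moreover have "diag_mat (B * B) = map (\<lambda>i. (B $$ (i,i))\<^sup>2) [0..<n]"
    unfolding diag_mat_def using BB e by (auto simp: power2_eq_square simp del: index_mult_mat(1))
  ultimately have "trace_norm X = (\<Sum>e\<leftarrow>map (\<lambda>i. (B $$ (i,i))\<^sup>2) [0..<n]. sqrt (cmod e))"
    using \<open>char_poly (P * P) = _\<close> X by (intro trace_norm_of_roots) (simp only:)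
  also have "\<dots> = (\<Sum>i<n. cmod (B $$ (i,i)))"
    by (simp add: comp_def interv_sum_list_conv_sum_set_nat atLeast0LessThan norm_power)
  finally have "complex_of_real (trace_norm X) = (\<Sum>i<n. of_real (cmod (B $$ (i,i))))" by simp
  also have "\<dots> = (\<Sum>i<n. B $$ (i,i))"
  proof (intro sum.cong refl)
    fix i assume "i \<in> {..<n}"
    hence "poly (char_poly B) (B $$ (i,i)) = 0"
      unfolding char_poly_upper_triangular[OF B(1,2)] using B(1)
      by (auto simp: poly_prod_list prod_list_zero_iff diag_mat_def)
    hence "eigenvalue P (B $$ (i,i))"
      using eigenvalue_root_char_poly[OF P(1)] char_poly_similar[OF B(3)] by simp
    from psd_eigenvalue[OF P this] show "of_real (cmod (B $$ (i,i))) = B $$ (i,i)" by simp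
  qed
  also have "\<dots> = mtrace B" using B by (simp add: mtrace_def)
  also have "\<dots> = mtrace (B * (T * S))" using w B by simp
  also have "\<dots> = mtrace (S * (B * T))" using w
    by (subst mtrace_mult_commute[of S n n]) (auto simp: assoc_mult_mat[of _ n n _ n _ n])
  also have "\<dots> = mtrace P" using w by (simp add: assoc_mult_mat[of _ n n _ n _ n])
  finally show ?thesis .
qed

text \<open>Without cross terms the squares of \<open>R0 - R1\<close> and \<open>R0 + R1\<close>
  coincide, so the absolute value of the difference is the sum, of trace 2.\<close>

lemma P_opt_orthogonal:
  assumes R: "R0 \<in> carrier_mat n n" "R1 \<in> carrier_mat n n" "density n R0" "density n R1"
    and orth: "R0 * R1 = 0\<^sub>m n n" "R1 * R0 = 0\<^sub>m n n" and sum: "psd (R0 + R1)"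
  shows "P_opt R0 R1 = 1"
proof -
  have h: "cadj R0 = R0" "cadj R1 = R1" using R unfolding density_def psd_def by auto
  have "cadj (R0 - R1) = cadj R0 - cadj R1" using R by (intro eq_matI) (auto simp: cadj_def)
  hence 1: "cadj (R0 - R1) * (R0 - R1) = (R0 - R1) * (R0 - R1)" using h by simp
  have "(R0 - R1) * (R0 - R1) = (R0 + R1) * (R0 + R1)"
  proof (rule eq_matI)
    have C: "R0 - R1 \<in> carrier_mat n n" "R0 + R1 \<in> carrier_mat n n" using R by auto
    fix i j assume "i < dim_row ((R0 + R1) * (R0 + R1))" "j < dim_col ((R0 + R1) * (R0 + R1))"
    hence ij: "i < n" "j < n" using R by auto
    have "(\<Sum>k<n. R0 $$ (i,k) * R1 $$ (k,j)) = 0" "(\<Sum>k<n. R1 $$ (i,k) * R0 $$ (k,j)) = 0"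
      using mult_mat_entry[OF R(1,2) ij] mult_mat_entry[OF R(2,1) ij] orth ij by auto
    thus "((R0 - R1) * (R0 - R1)) $$ (i,j) = ((R0 + R1) * (R0 + R1)) $$ (i,j)"
      unfolding mult_mat_entry[OF C(1) C(1) ij] mult_mat_entry[OF C(2) C(2) ij] using R ij
      by (simp add: algebra_simps sum.distrib sum_subtractf)
  qed (use R in auto)
  hence "of_real (trace_norm (R0 - R1)) = mtrace (R0 + R1)"
    using R sum 1 by (intro trace_norm_psd_square[where n=n]) auto
  also have "\<dots> = mtrace R0 + mtrace R1" using R by (simp add: mtrace_def sum.distrib)
  also have "\<dots> = of_real 2" using R by (simp add: density_def)
  finally have "trace_norm (R0 - R1) = 2" by (simp only: of_real_eq_iff)
  thus ?thesis by (simp add: P_opt_def)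
qed

section \<open>Kronecker products and LOCC\<close>

lemma kron_carrier [simp]:
  "A \<in> carrier_mat r c \<Longrightarrow> B \<in> carrier_mat r' c' \<Longrightarrow> kron A B \<in> carrier_mat (r * r') (c * c')"
  by (auto simp: kron_def)

lemma kron_entry:
  assumes "A \<in> carrier_mat r c" "B \<in> carrier_mat r' c'" "i < r * r'" "j < c * c'"
  shows "kron A B $$ (i,j) = A $$ (i div r', j div c') * B $$ (i mod r', j mod c')"
  using assms by (auto simp: kron_def)

lemma div_mod_less_mult:
  assumes "(i::nat) < n * m"
  shows "i div m < n" "i mod m < m"
proof -
  have "0 < m" using assms by (auto intro: Nat.gr0I)
  thus "i div m < n" "i mod m < m" using assms by (auto simp: less_mult_imp_div_less)
qed

lemma kron_mult:
  assumes "X \<in> carrier_mat r n" "Y \<in> carrier_mat r' n'" "Z \<in> carrier_mat n c" "W \<in> carrier_mat n' c'"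
  shows "kron X Y * kron Z W = kron (X * Z) (Y * W)"
proof (rule eq_matI)
  have C: "kron X Y \<in> carrier_mat (r * r') (n * n')" "kron Z W \<in> carrier_mat (n * n') (c * c')"
    "X * Z \<in> carrier_mat r c" "Y * W \<in> carrier_mat r' c'"
    using assms by auto
  fix i j assume "i < dim_row (kron (X * Z) (Y * W))" "j < dim_col (kron (X * Z) (Y * W))"
  hence ij: "i < r * r'" "j < c * c'" using kron_carrier[OF C(3,4)] by auto
  note d = div_mod_less_mult[OF ij(1)] div_mod_less_mult[OF ij(2)]
  have "(kron X Y * kron Z W) $$ (i,j)
     = (\<Sum>a<n. \<Sum>b<n'. kron X Y $$ (i, a * n' + b) * kron Z W $$ (a * n' + b, j))"
    unfolding mult_mat_entry[OF C(1,2) ij] by (rule sum_mult_index)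
  also have "\<dots> = (\<Sum>a<n. \<Sum>b<n'. (X $$ (i div r', a) * Z $$ (a, j div c')) * (Y $$ (i mod r', b) * W $$ (b, j mod c')))"
    using ij by (auto simp: kron_entry[OF assms(1,2)] kron_entry[OF assms(3,4)] pair_index_less mult_ac intro!: sum.cong)
  also have "\<dots> = kron (X * Z) (Y * W) $$ (i,j)"
    unfolding kron_entry[OF C(3,4) ij]
    using d by (simp add: mult_mat_entry[OF assms(1,3)] mult_mat_entry[OF assms(2,4)] sum_product del: index_mult_mat(1))
  finally show "(kron X Y * kron Z W) $$ (i,j) = kron (X * Z) (Y * W) $$ (i,j)" .
qed (use assms in \<open>auto simp: kron_def\<close>)

lemma kron_one: "kron (1\<^sub>m n) (1\<^sub>m m) = 1\<^sub>m (n * m)"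
proof (rule eq_matI)
  fix i j assume "i < dim_row (1\<^sub>m (n * m) :: complex mat)" "j < dim_col (1\<^sub>m (n * m) :: complex mat)"
  hence ij: "i < n * m" "j < n * m" by auto
  have "(i div m = j div m \<and> i mod m = j mod m) = (i = j)"
    by (metis div_mult_mod_eq)
  thus "kron (1\<^sub>m n) (1\<^sub>m m) $$ (i,j) = 1\<^sub>m (n * m) $$ (i,j)"
    using ij div_mod_less_mult[OF ij(1)] div_mod_less_mult[OF ij(2)] by (auto simp: kron_def)
qed (auto simp: kron_def)

lemma cadj_kron:
  "A \<in> carrier_mat r c \<Longrightarrow> B \<in> carrier_mat r' c' \<Longrightarrow> cadj (kron A B) = kron (cadj A) (cadj B)"
  by (rule eq_matI) (auto simp: kron_def cadj_def div_mod_less_mult)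

lemma cadj_one: "cadj (1\<^sub>m n) = 1\<^sub>m n"
  by (rule eq_matI) (auto simp: cadj_def)

lemma cadj_mult:
  assumes "A \<in> carrier_mat r n" "B \<in> carrier_mat n c"
  shows "cadj (A * B) = cadj B * cadj A"
proof (rule eq_matI)
  fix i j assume "i < dim_row (cadj B * cadj A)" "j < dim_col (cadj B * cadj A)"
  hence ij: "i < c" "j < r" using assms by (auto simp: cadj_def)
  show "cadj (A * B) $$ (i,j) = (cadj B * cadj A) $$ (i,j)"
    unfolding cadj_entry[OF mult_carrier_mat[OF assms] ij] mult_mat_entry[OF assms ij(2,1)]
      mult_mat_entry[OF cadj_carrier[OF assms(2)] cadj_carrier[OF assms(1)] ij]
    using ij assms by (auto simp: cadj_entry mult.commute intro!: sum.cong)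
qed (use assms in \<open>auto simp: cadj_def\<close>)

lemma kron_add:
  assumes "C \<in> carrier_mat r c" "D \<in> carrier_mat r c"
  shows "kron (C + D) E = kron C E + kron D E"
    and "kron E (C + D) = kron E C + kron E D"
  using assms by (auto simp: kron_def div_mod_less_mult distrib_left distrib_right)

lemma mtrace_add: "A \<in> carrier_mat n n \<Longrightarrow> B \<in> carrier_mat n n \<Longrightarrow> mtrace (A + B) = mtrace A + mtrace B"
  by (auto simp: mtrace_def sum.distrib)

section \<open>Leaves of an LOCC protocol and a dual bound on the LOCC norm\<close>

lemma foldr_gram_carrier:
  assumes "list_all (\<lambda>(A, L). dim_col A = n \<and> Q A L) ps"
  shows "foldr (\<lambda>(A, L) S. cadj A * A + S) ps (0\<^sub>m n n) \<in> carrier_mat n n"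
  using assms by (induction ps) (auto simp: cadj_def)

lemma sum_list_linear_gram:
  assumes "list_all (\<lambda>(A, L). dim_col A = n \<and> Q A L) ps"
    and add: "\<And>C D. C \<in> carrier_mat n n \<Longrightarrow> D \<in> carrier_mat n n \<Longrightarrow> \<phi> (C + D) = \<phi> C + \<phi> D"
    and "\<phi> (0\<^sub>m n n) = (0::complex)"
  shows "(\<Sum>(A, L)\<leftarrow>ps. \<phi> (cadj A * A)) = \<phi> (foldr (\<lambda>(A, L) S. cadj A * A + S) ps (0\<^sub>m n n))"
  using assms(1)
proof (induction ps)
  case (Cons q ps)
  obtain A L where q: "q = (A, L)" by force
  have "foldr (\<lambda>(A, L) S. cadj A * A + S) ps (0\<^sub>m n n) \<in> carrier_mat n n"
    by (rule foldr_gram_carrier[of n Q]) (use Cons in auto)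
  moreover have "cadj A * A \<in> carrier_mat n n" using Cons q by (auto simp: cadj_def)
  ultimately show ?case using Cons q add by simp
qed (use assms in simp)

text \<open>Each local step multiplies one tensor factor only. Together with trace preservation this
  is all that the upper bound on the LOCC norm extracts from LOCC.\<close>

lemma locc_product:
  "locc a b af bf L \<Longrightarrow> (K, lab) \<in> set L \<Longrightarrow> \<exists>A B. A \<in> carrier_mat af a \<and> B \<in> carrier_mat bf b \<and> K = kron A B"
proof (induction arbitrary: K lab rule: locc.induct)
  case (leaf a b lab)
  hence "K = kron (1\<^sub>m a) (1\<^sub>m b)" by (simp add: kron_one)
  thus ?case using one_carrier_mat by blast
next
  case (alice a b af bf ps)
  from alice(3) obtain A L K' where A: "(A, L) \<in> set ps" "(K', lab) \<in> set L" "K = K' * kron A (1\<^sub>m b)" by auto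
  note step = bspec[OF alice(1)[unfolded list_all_iff] A(1)]
  from step have C: "A \<in> carrier_mat (dim_row A) a" by auto
  have IH: "\<exists>A' B'. A' \<in> carrier_mat af (dim_row A) \<and> B' \<in> carrier_mat bf b \<and> K = kron A' B'" if "(K, lab) \<in> set L" for K lab
    using step that by simp blast
  from IH[OF A(2)] obtain A' B' where B: "A' \<in> carrier_mat af (dim_row A)" "B' \<in> carrier_mat bf b" "K' = kron A' B'"
    by blast
  have "K = kron (A' * A) B'"
    unfolding A(3) B(3) kron_mult[OF B(1,2) C one_carrier_mat] using B(2) by simp
  thus ?case using B(2) mult_carrier_mat[OF B(1) C] by blast
next
  case (bob b a af bf ps)
  from bob(3) obtain B L K' where A: "(B, L) \<in> set ps" "(K', lab) \<in> set L" "K = K' * kron (1\<^sub>m a) B" by auto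
  note step = bspec[OF bob(1)[unfolded list_all_iff] A(1)]
  from step have C: "B \<in> carrier_mat (dim_row B) b" by auto
  have IH: "\<exists>A' B'. A' \<in> carrier_mat af a \<and> B' \<in> carrier_mat bf (dim_row B) \<and> K = kron A' B'" if "(K, lab) \<in> set L" for K lab
    using step that by simp blast
  from IH[OF A(2)] obtain A' B' where B: "A' \<in> carrier_mat af a" "B' \<in> carrier_mat bf (dim_row B)" "K' = kron A' B'"
    by blast
  have "K = kron A' (B' * B)"
    unfolding A(3) B(3) kron_mult[OF B(1,2) one_carrier_mat C] using B(1) by simp
  thus ?case using B(1) mult_carrier_mat[OF B(2) C] by blast
qed

lemma sum_list_map_concat_map:
  fixes F :: "'b \<Rightarrow> 'c::comm_monoid_add"
  shows "sum_list (map F (concat (map G xs))) = (\<Sum>x\<leftarrow>xs. sum_list (map F (G x)))"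
  by (induction xs) auto

lemma mtrace_sandwich_mult:
  assumes "K \<in> carrier_mat r n" "G \<in> carrier_mat n l" "X \<in> carrier_mat l l"
  shows "mtrace ((K * G) * X * cadj (K * G)) = mtrace (K * (G * X * cadj G) * cadj K)"
proof -
  note G' = cadj_carrier[OF assms(2)] and K' = cadj_carrier[OF assms(1)]
  note GX = mult_carrier_mat[OF assms(2,3)]
  have "(K * G) * X * (cadj G * cadj K) = K * (G * X) * (cadj G * cadj K)"
    by (simp only: assoc_mult_mat[OF assms])
  also have "\<dots> = K * (G * X) * cadj G * cadj K"
    by (rule assoc_mult_mat[OF mult_carrier_mat[OF assms(1) GX] G' K', symmetric])
  also have "K * (G * X) * cadj G = K * (G * X * cadj G)"
    by (rule assoc_mult_mat[OF assms(1) GX G'])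
  finally have "(K * G) * X * (cadj G * cadj K) = K * (G * X * cadj G) * cadj K" .
  thus ?thesis using cadj_mult[OF assms(1,2)] by simp
qed

text \<open>Completeness of the leaves, in the weak form of a trace identity for every
  \<open>X\<close>. The operator must be arbitrary in the induction, since the subprotocol after a
  local outcome acts on the sandwiched operator.\<close>

lemma locc_trace_preserving:
  "locc a b af bf L \<Longrightarrow> X \<in> carrier_mat (a * b) (a * b)
    \<Longrightarrow> (\<Sum>(K, lab)\<leftarrow>L. mtrace (K * X * cadj K)) = mtrace X"
proof (induction arbitrary: X rule: locc.induct)
  case (leaf a b lab)
  thus ?case by (simp add: cadj_one)
next
  case (alice a b af bf ps)
  \<comment> \<open>Each branch contributes a linear functional evaluated at
    \<open>cadj A * A\<close>; by linearity the sum over branches is its value at the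
    identity.\<close>
  define \<phi> where "\<phi> C = mtrace (kron C (1\<^sub>m b) * X)" for C
  have all: "list_all (\<lambda>(A, L). dim_col A = a \<and> True) ps" using alice(1) by (auto simp: list_all_iff)
  have \<phi>: "\<phi> (foldr (\<lambda>(A, L) S. cadj A * A + S) ps (0\<^sub>m a a)) = (\<Sum>(A, L)\<leftarrow>ps. \<phi> (cadj A * A))"
  proof (rule sum_list_linear_gram[OF all, symmetric])
    show "\<phi> (0\<^sub>m a a) = 0"
    proof -
      have "kron (0\<^sub>m a a) (1\<^sub>m b) = 0\<^sub>m (a * b) (a * b)"
        by (rule eq_matI) (auto simp: kron_def div_mod_less_mult)
      thus ?thesis using alice(3) by (simp add: \<phi>_def mtrace_def)
    qed
    fix C D :: "complex mat" assume CD: "C \<in> carrier_mat a a" "D \<in> carrier_mat a a"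
    show "\<phi> (C + D) = \<phi> C + \<phi> D" unfolding \<phi>_def kron_add(1)[OF CD]
      using CD alice(3) by (subst add_mult_distrib_mat[of _ "a*b" "a*b"]) (auto intro!: mtrace_add[of _ "a * b"] mult_carrier_mat[of _ "a*b" "a*b"])
  qed
  have "(\<Sum>(K, lab)\<leftarrow>L. mtrace ((K * kron A (1\<^sub>m b)) * X * cadj (K * kron A (1\<^sub>m b)))) = \<phi> (cadj A * A)"
    if "(A, L) \<in> set ps" for A L
  proof -
    let ?G = "kron A (1\<^sub>m b)"
    from alice(1) that have A: "A \<in> carrier_mat (dim_row A) a" and l: "locc (dim_row A) b af bf L"
      and IH: "\<And>Y. Y \<in> carrier_mat (dim_row A * b) (dim_row A * b) \<Longrightarrow> (\<Sum>(K, lab)\<leftarrow>L. mtrace (K * Y * cadj K)) = mtrace Y"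
      by (auto simp: list_all_iff)
    have G: "?G \<in> carrier_mat (dim_row A * b) (a * b)" by (rule kron_carrier[OF A one_carrier_mat])
    have "(\<Sum>(K, lab)\<leftarrow>L. mtrace ((K * ?G) * X * cadj (K * ?G))) = (\<Sum>(K, lab)\<leftarrow>L. mtrace (K * (?G * X * cadj ?G) * cadj K))"
    proof (intro arg_cong[where f=sum_list] map_cong refl, clarify)
      fix K lab assume "(K, lab) \<in> set L"
      from locc_product[OF l this] have "K \<in> carrier_mat (af * bf) (dim_row A * b)" by auto
      from mtrace_sandwich_mult[OF this G alice(3)]
      show "mtrace ((K * ?G) * X * cadj (K * ?G)) = mtrace (K * (?G * X * cadj ?G) * cadj K)" .
    qed
    also have "\<dots> = mtrace (?G * X * cadj ?G)"
      by (rule IH[OF sandwich_carrier[OF G alice(3)]])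
    also have "\<dots> = mtrace (cadj ?G * ?G * X)" by (rule mtrace_gram_mult[OF G alice(3), symmetric])
    also have "cadj ?G * ?G = kron (cadj A * A) (1\<^sub>m b)"
      by (simp add: cadj_kron[OF A one_carrier_mat] cadj_one kron_mult[OF cadj_carrier[OF A] one_carrier_mat A one_carrier_mat])
    finally show ?thesis by (simp add: \<phi>_def)
  qed
  hence "(\<Sum>(K, lab)\<leftarrow>concat (map (\<lambda>(A, L). map (\<lambda>(K, lab). (K * kron A (1\<^sub>m b), lab)) L) ps). mtrace (K * X * cadj K))
     = (\<Sum>(A, L)\<leftarrow>ps. \<phi> (cadj A * A))"
    unfolding sum_list_map_concat_map
    by (intro arg_cong[where f=sum_list] map_cong refl) (auto simp: comp_def split_def)
  also have "\<dots> = \<phi> (1\<^sub>m a)" using \<phi> alice(2) by simp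
  also have "\<dots> = mtrace X" using alice(3) by (simp add: \<phi>_def kron_one)
  finally show ?case .
next
  case (bob b a af bf ps)
  define \<phi> where "\<phi> C = mtrace (kron (1\<^sub>m a) C * X)" for C
  have all: "list_all (\<lambda>(A, L). dim_col A = b \<and> True) ps" using bob(1) by (auto simp: list_all_iff)
  have \<phi>: "\<phi> (foldr (\<lambda>(A, L) S. cadj A * A + S) ps (0\<^sub>m b b)) = (\<Sum>(A, L)\<leftarrow>ps. \<phi> (cadj A * A))"
  proof (rule sum_list_linear_gram[OF all, symmetric])
    show "\<phi> (0\<^sub>m b b) = 0"
    proof -
      have "kron (1\<^sub>m a) (0\<^sub>m b b) = 0\<^sub>m (a * b) (a * b)"
        by (rule eq_matI) (auto simp: kron_def div_mod_less_mult)
      thus ?thesis using bob(3) by (simp add: \<phi>_def mtrace_def)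
    qed
    fix C D :: "complex mat" assume CD: "C \<in> carrier_mat b b" "D \<in> carrier_mat b b"
    show "\<phi> (C + D) = \<phi> C + \<phi> D" unfolding \<phi>_def kron_add(2)[OF CD]
      using CD bob(3) by (subst add_mult_distrib_mat[of _ "a*b" "a*b"]) (auto intro!: mtrace_add[of _ "a * b"] mult_carrier_mat[of _ "a*b" "a*b"])
  qed
  have "(\<Sum>(K, lab)\<leftarrow>L. mtrace ((K * kron (1\<^sub>m a) B) * X * cadj (K * kron (1\<^sub>m a) B))) = \<phi> (cadj B * B)"
    if "(B, L) \<in> set ps" for B L
  proof -
    let ?G = "kron (1\<^sub>m a) B"
    from bob(1) that have B: "B \<in> carrier_mat (dim_row B) b" and l: "locc a (dim_row B) af bf L"
      and IH: "\<And>Y. Y \<in> carrier_mat (a * dim_row B) (a * dim_row B) \<Longrightarrow> (\<Sum>(K, lab)\<leftarrow>L. mtrace (K * Y * cadj K)) = mtrace Y"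
      by (auto simp: list_all_iff)
    have G: "?G \<in> carrier_mat (a * dim_row B) (a * b)" by (rule kron_carrier[OF one_carrier_mat B])
    have "(\<Sum>(K, lab)\<leftarrow>L. mtrace ((K * ?G) * X * cadj (K * ?G))) = (\<Sum>(K, lab)\<leftarrow>L. mtrace (K * (?G * X * cadj ?G) * cadj K))"
    proof (intro arg_cong[where f=sum_list] map_cong refl, clarify)
      fix K lab assume "(K, lab) \<in> set L"
      from locc_product[OF l this] have "K \<in> carrier_mat (af * bf) (a * dim_row B)" by auto
      from mtrace_sandwich_mult[OF this G bob(3)]
      show "mtrace ((K * ?G) * X * cadj (K * ?G)) = mtrace (K * (?G * X * cadj ?G) * cadj K)" .
    qed
    also have "\<dots> = mtrace (?G * X * cadj ?G)"
      by (rule IH[OF sandwich_carrier[OF G bob(3)]])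
    also have "\<dots> = mtrace (cadj ?G * ?G * X)" by (rule mtrace_gram_mult[OF G bob(3), symmetric])
    also have "cadj ?G * ?G = kron (1\<^sub>m a) (cadj B * B)"
      by (simp add: cadj_kron[OF one_carrier_mat B] cadj_one kron_mult[OF one_carrier_mat cadj_carrier[OF B] one_carrier_mat B])
    finally show ?thesis by (simp add: \<phi>_def)
  qed
  hence "(\<Sum>(K, lab)\<leftarrow>concat (map (\<lambda>(B, L). map (\<lambda>(K, lab). (K * kron (1\<^sub>m a) B, lab)) L) ps). mtrace (K * X * cadj K))
     = (\<Sum>(A, L)\<leftarrow>ps. \<phi> (cadj A * A))"
    unfolding sum_list_map_concat_map
    by (intro arg_cong[where f=sum_list] map_cong refl) (auto simp: comp_def split_def)
  also have "\<dots> = \<phi> (1\<^sub>m b)" using \<phi> bob(2) by simp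
  also have "\<dots> = mtrace X" using bob(3) by (simp add: \<phi>_def kron_one)
  finally show ?case .
qed

text \<open>Triangle inequality: merging leaves with the same label cannot increase the total
  modulus.\<close>

lemma sum_cmod_grouped_le:
  fixes N :: nat
  assumes "list_all (\<lambda>(K, lab). lab < N) L"
  shows "(\<Sum>i<N. cmod (\<Sum>(K, lab)\<leftarrow>L. if lab = i then f K else 0)) \<le> (\<Sum>(K, lab)\<leftarrow>L. cmod (f K))"
  using assms
proof (induction L)
  case (Cons q L)
  obtain K lab where q: "q = (K, lab)" by force
  have "(\<Sum>i<N. cmod (\<Sum>(K, lab)\<leftarrow>q # L. if lab = i then f K else 0))
     \<le> (\<Sum>i<N. (if lab = i then cmod (f K) else 0) + cmod (\<Sum>(K, lab)\<leftarrow>L. if lab = i then f K else 0))"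
    by (intro sum_mono) (auto simp: q intro: norm_triangle_ineq)
  also have "\<dots> \<le> cmod (f K) + (\<Sum>(K, lab)\<leftarrow>L. cmod (f K))"
  proof -
    have "lab < N" and L: "list_all (\<lambda>(K, lab). lab < N) L" using Cons.prems q by auto
    hence "(\<Sum>i<N. if lab = i then cmod (f K) else 0) = cmod (f K)" by (subst sum.delta') auto
    thus ?thesis using Cons.IH[OF L] by (simp only: sum.distrib)
  qed
  finally show ?case by (simp add: q)
qed simp

lemma povm_el_carrier:
  assumes "\<And>K lab. (K, lab) \<in> set L \<Longrightarrow> dim_col K = n"
  shows "povm_el n L i \<in> carrier_mat n n"
  using assms
proof (induction L)
  case (Cons q L)
  obtain K lab where q: "q = (K, lab)" by force
  have "dim_col K = n" "\<And>K lab. (K, lab) \<in> set L \<Longrightarrow> dim_col K = n" using Cons.prems q by auto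
  with Cons.IH show ?case by (auto simp: q povm_el_def cadj_def)
qed (simp add: povm_el_def)

lemma mtrace_povm_el:
  assumes "\<And>K lab. (K, lab) \<in> set L \<Longrightarrow> dim_col K = n" and X: "X \<in> carrier_mat n n"
  shows "mtrace (povm_el n L i * X) = (\<Sum>(K, lab)\<leftarrow>L. if lab = i then mtrace (K * X * cadj K) else 0)"
  using assms(1)
proof (induction L)
  case Nil
  show ?case using X by (simp add: povm_el_def mtrace_def)
next
  case (Cons q L)
  obtain K lab where q: "q = (K, lab)" by force
  have K: "K \<in> carrier_mat (dim_row K) n" and L: "\<And>K lab. (K, lab) \<in> set L \<Longrightarrow> dim_col K = n"
    using Cons.prems q by auto
  define E where "E = (if lab = i then cadj K * K else 0\<^sub>m n n)"
  have E: "E \<in> carrier_mat n n" using mult_carrier_mat[OF cadj_carrier[OF K] K] by (simp add: E_def)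
  have "povm_el n (q # L) i = E + povm_el n L i" by (simp add: q povm_el_def E_def)
  hence "mtrace (povm_el n (q # L) i * X) = mtrace (E * X) + mtrace (povm_el n L i * X)"
    using E X povm_el_carrier[OF L]
    by (simp add: add_mult_distrib_mat[of _ n n] mtrace_add[of _ n] mult_carrier_mat[of _ n n _ n])
  moreover have "mtrace (E * X) = (if lab = i then mtrace (K * X * cadj K) else 0)"
    using X mtrace_gram_mult[OF K X] by (auto simp: E_def mtrace_def)
  ultimately show ?case using Cons.IH[OF L] by (simp add: q)
qed

text \<open>A dual certificate: an operator \<open>T\<close> that dominates \<open>X\<close> on all
  product effects bounds every LOCC measurement by its trace, because the leaves are complete.
  \<open>T\<close> may have negative eigenvalues; only its values on product effects matter.\<close>

lemma locc_norm_le: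
  assumes X: "X \<in> carrier_mat (dA * dB) (dA * dB)" and T: "T \<in> carrier_mat (dA * dB) (dA * dB)"
    and bound: "\<And>A B af bf. A \<in> carrier_mat af dA \<Longrightarrow> B \<in> carrier_mat bf dB \<Longrightarrow>
      cmod (mtrace (kron A B * X * cadj (kron A B))) \<le> Re (mtrace (kron A B * T * cadj (kron A B)))"
  shows "locc_norm dA dB X \<le> Re (mtrace T)"
  unfolding locc_norm_def
proof (rule cSup_least)
  have "locc_meas dA dB 1 [(1\<^sub>m (dA * dB), 0)]" unfolding locc_meas_def by (auto intro: locc.leaf)
  thus "{trace_norm (meas_channel dA dB N L X) |N L. locc_meas dA dB N L} \<noteq> {}" by blast
next
  fix t assume "t \<in> {trace_norm (meas_channel dA dB N L X) |N L. locc_meas dA dB N L}"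
  then obtain N L af bf where t: "t = trace_norm (meas_channel dA dB N L X)"
    and L: "locc dA dB af bf L" "list_all (\<lambda>(K, lab). lab < N) L"
    unfolding locc_meas_def by auto
  have dim: "dim_col K = dA * dB" if "(K, lab) \<in> set L" for K lab
    using locc_product[OF L(1) that] by (auto simp: kron_def)
  have "t = (\<Sum>i<N. cmod (\<Sum>(K, lab)\<leftarrow>L. if lab = i then mtrace (K * X * cadj K) else 0))"
    unfolding t meas_channel_def trace_norm_diag using dim X by (simp add: mtrace_povm_el)
  also have "\<dots> \<le> (\<Sum>(K, lab)\<leftarrow>L. cmod (mtrace (K * X * cadj K)))"
    by (rule sum_cmod_grouped_le[OF L(2)])
  also have "\<dots> \<le> (\<Sum>(K, lab)\<leftarrow>L. Re (mtrace (K * T * cadj K)))"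
  proof (rule sum_list_mono)
    fix q assume "q \<in> set L"
    moreover obtain K lab where q: "q = (K, lab)" by force
    ultimately obtain A B where "A \<in> carrier_mat af dA" "B \<in> carrier_mat bf dB" "K = kron A B"
      using locc_product[OF L(1)] by blast
    thus "(case q of (K, lab) \<Rightarrow> cmod (mtrace (K * X * cadj K))) \<le> (case q of (K, lab) \<Rightarrow> Re (mtrace (K * T * cadj K)))"
      using bound q by simp
  qed
  also have "\<dots> = Re (\<Sum>(K, lab)\<leftarrow>L. mtrace (K * T * cadj K))"
  proof -
    have "(\<Sum>(K, lab)\<leftarrow>xs. Re (g K)) = Re (\<Sum>(K, lab)\<leftarrow>xs. g K)"
      for g :: "complex mat \<Rightarrow> complex" and xs :: "(complex mat \<times> nat) list"
      by (induction xs) auto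
    thus ?thesis .
  qed
  also have "\<dots> = Re (mtrace T)" using locc_trace_preserving[OF L(1) T] by simp
  finally show "t \<le> Re (mtrace T)" .
qed

section \<open>One-way protocols from entrywise completeness relations\<close>

lemma foldr_gram_entry:
  assumes "\<And>x. x \<in> set xs \<Longrightarrow> A x \<in> carrier_mat m n" "i < n" "j < n"
  shows "foldr (\<lambda>(A, L) S. cadj A * A + S) (map (\<lambda>x. (A x, L x)) xs) (0\<^sub>m n n) $$ (i,j)
     = (\<Sum>x\<leftarrow>xs. \<Sum>k<m. cnj (A x $$ (k,i)) * A x $$ (k,j))"
  using assms(1)
proof (induction xs)
  case (Cons x xs)
  have A: "A x \<in> carrier_mat m n" using Cons.prems by simp
  have C: "foldr (\<lambda>(A, L) S. cadj A * A + S) (map (\<lambda>x. (A x, L x)) xs) (0\<^sub>m n n) \<in> carrier_mat n n"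
    by (rule foldr_gram_carrier[of n "\<lambda>_ _. True"]) (use Cons.prems in \<open>auto simp: list_all_iff\<close>)
  have "foldr (\<lambda>(A, L) S. cadj A * A + S) (map (\<lambda>x. (A x, L x)) (x # xs)) (0\<^sub>m n n) $$ (i,j)
     = (cadj (A x) * A x) $$ (i,j) + foldr (\<lambda>(A, L) S. cadj A * A + S) (map (\<lambda>x. (A x, L x)) xs) (0\<^sub>m n n) $$ (i,j)"
    using C assms(2,3) by simp
  thus ?case using Cons cadj_mult_entry[OF A assms(2,3)] by simp
qed (use assms in simp)

lemma foldr_gram_eq_one:
  assumes A: "\<And>x. x \<in> set xs \<Longrightarrow> A x \<in> carrier_mat m n"
    and "\<And>i j. i < n \<Longrightarrow> j < n \<Longrightarrow>
      (\<Sum>x\<leftarrow>xs. \<Sum>k<m. cnj (A x $$ (k,i)) * A x $$ (k,j)) = (if i = j then 1 else 0)"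
  shows "foldr (\<lambda>(A, L) S. cadj A * A + S) (map (\<lambda>x. (A x, L x)) xs) (0\<^sub>m n n) = 1\<^sub>m n"
proof -
  have C: "foldr (\<lambda>(A, L) S. cadj A * A + S) (map (\<lambda>x. (A x, L x)) xs) (0\<^sub>m n n) \<in> carrier_mat n n"
    by (rule foldr_gram_carrier[of n "\<lambda>_ _. True"]) (use A in \<open>auto simp: list_all_iff\<close>)
  show ?thesis
  proof (rule eq_matI)
    fix i j assume "i < dim_row (1\<^sub>m n :: complex mat)" "j < dim_col (1\<^sub>m n :: complex mat)"
    hence "i < n" "j < n" by auto
    thus "foldr (\<lambda>(A, L) S. cadj A * A + S) (map (\<lambda>x. (A x, L x)) xs) (0\<^sub>m n n) $$ (i,j) = 1\<^sub>m n $$ (i,j)"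
      using assms(2) foldr_gram_entry[where xs=xs and A=A and m=m and n=n and L=L, OF A] by simp
  qed (use C in auto)
qed

text \<open>Alice measures, sends \<open>x\<close>, and Bob picks his measurement accordingly.
  One-way communication suffices for teleportation, and both completeness conditions are left as
  identities between entries.\<close>

lemma locc_two_step:
  assumes A: "\<And>x. x \<in> set xs \<Longrightarrow> A x \<in> carrier_mat m a"
    and B: "\<And>x y. x \<in> set xs \<Longrightarrow> y \<in> set ys \<Longrightarrow> B x y \<in> carrier_mat n b"
    and sumA: "\<And>i j. i < a \<Longrightarrow> j < a \<Longrightarrow>
      (\<Sum>x\<leftarrow>xs. \<Sum>k<m. cnj (A x $$ (k,i)) * A x $$ (k,j)) = (if i = j then 1 else 0)"
    and sumB: "\<And>x i j. x \<in> set xs \<Longrightarrow> i < b \<Longrightarrow> j < b \<Longrightarrow>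
      (\<Sum>y\<leftarrow>ys. \<Sum>k<n. cnj (B x y $$ (k,i)) * B x y $$ (k,j)) = (if i = j then 1 else 0)"
  shows "locc a b m n (concat (map (\<lambda>x. map (\<lambda>y. (kron (A x) (B x y), lab x y)) ys) xs))"
proof -
  define L where "L x = map (\<lambda>y. (kron (1\<^sub>m m) (B x y), lab x y)) ys" for x
  have L: "locc m b m n (L x)" if x: "x \<in> set xs" for x
  proof -
    define ps where "ps = map (\<lambda>y. (B x y, [(1\<^sub>m (m * n) :: complex mat, lab x y)])) ys"
    have "list_all (\<lambda>(B, L). dim_col B = b \<and> locc m (dim_row B) m n L) ps"
      using B[OF x] by (auto simp: ps_def list_all_iff intro: locc.leaf)
    moreover have "foldr (\<lambda>(B, L) S. cadj B * B + S) ps (0\<^sub>m b b) = 1\<^sub>m b"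
      unfolding ps_def by (rule foldr_gram_eq_one[OF B[OF x] sumB[OF x]])
    ultimately have "locc m b m n (concat (map (\<lambda>(B, L). map (\<lambda>(K, lab). (K * kron (1\<^sub>m m) B, lab)) L) ps))"
      by (rule locc.bob)
    moreover have "concat (map (\<lambda>(B, L). map (\<lambda>(K, lab). (K * kron (1\<^sub>m m) B, lab)) L) ps)
        = concat (map (\<lambda>y. [(kron (1\<^sub>m m) (B x y), lab x y)]) ys)"
    proof -
      have "1\<^sub>m (m * n) * kron (1\<^sub>m m) (B x y) = kron (1\<^sub>m m) (B x y)" if "y \<in> set ys" for y
        by (rule left_mult_one_mat[OF kron_carrier[OF one_carrier_mat B[OF x that]]])
      thus ?thesis by (simp add: ps_def comp_def cong: map_cong)
    qed
    moreover have "concat (map (\<lambda>y. [h y]) ys) = map h ys" for h :: "'b \<Rightarrow> complex mat \<times> 'c" by (induction ys) auto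
    ultimately show ?thesis by (simp add: L_def)
  qed
  define ps where "ps = map (\<lambda>x. (A x, L x)) xs"
  have "list_all (\<lambda>(A, L). dim_col A = a \<and> locc (dim_row A) b m n L) ps"
    using A L by (auto simp: ps_def list_all_iff)
  moreover have "foldr (\<lambda>(A, L) S. cadj A * A + S) ps (0\<^sub>m a a) = 1\<^sub>m a"
    unfolding ps_def by (rule foldr_gram_eq_one[OF A sumA])
  ultimately have "locc a b m n (concat (map (\<lambda>(A, L). map (\<lambda>(K, lab). (K * kron A (1\<^sub>m b), lab)) L) ps))"
    by (rule locc.alice)
  moreover have "map (\<lambda>(A, L). map (\<lambda>(K, lab). (K * kron A (1\<^sub>m b), lab)) L) ps
      = map (\<lambda>x. map (\<lambda>y. (kron (A x) (B x y), lab x y)) ys) xs"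
  proof -
    have "kron (1\<^sub>m m) (B x y) * kron (A x) (1\<^sub>m b) = kron (A x) (B x y)" if "x \<in> set xs" "y \<in> set ys" for x y
      using kron_mult[OF one_carrier_mat B[OF that] A[OF that(1)] one_carrier_mat] A[OF that(1)] B[OF that] by simp
    thus ?thesis by (simp add: ps_def L_def comp_def cong: map_cong)
  qed
  ultimately show ?thesis by simp
qed

section \<open>The hiding states\<close>

lemma psd_add:
  assumes "A \<in> carrier_mat n n" "B \<in> carrier_mat n n" "psd A" "psd B"
  shows "psd (A + B)"
proof -
  have "cadj (A + B) = cadj A + cadj B" using assms by (intro eq_matI) (auto simp: cadj_def)
  moreover have "conjugate v \<bullet> ((A + B) *\<^sub>v v) = conjugate v \<bullet> (A *\<^sub>v v) + conjugate v \<bullet> (B *\<^sub>v v)"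
    if v: "v \<in> carrier_vec n" for v
  proof -
    have "(A + B) *\<^sub>v v = A *\<^sub>v v + B *\<^sub>v v" by (rule add_mult_distrib_mat_vec[OF assms(1,2) v])
    thus ?thesis using assms v by (simp add: scalar_prod_add_distrib[of _ n])
  qed
  ultimately show ?thesis using assms by (auto simp: psd_def)
qed

lemma mtrace_sandwich_linear:
  assumes "L \<in> carrier_mat r n" "X \<in> carrier_mat n n" "Y \<in> carrier_mat n n"
  shows "mtrace (L * (X + Y) * cadj L) = mtrace (L * X * cadj L) + mtrace (L * Y * cadj L)"
    and "mtrace (L * (X - Y) * cadj L) = mtrace (L * X * cadj L) - mtrace (L * Y * cadj L)"
  unfolding mtrace_sandwich[OF assms(1) add_carrier_mat[OF assms(3)]] mtrace_sandwich[OF assms(1,2)]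
    mtrace_sandwich[OF assms(1) minus_carrier_mat[OF assms(3)]] mtrace_sandwich[OF assms(1,3)]
  using assms by (simp_all add: distrib_left distrib_right left_diff_distrib right_diff_distrib sum.distrib sum_subtractf)

text \<open>The eigenvalue of the swap on the hidden component: bit \<open>False\<close> is hidden
  in the symmetric subspace, \<open>True\<close> in the antisymmetric one.\<close>

definition sg :: "bool \<Rightarrow> real" where
  "sg z = (if z then -1 else 1)"

locale hiding =
  fixes d K :: nat and p :: real
  assumes d2: "2 \<le> d" and K1: "1 \<le> K" and p0: "0 < p" and p1: "p < 1"
begin

text \<open>The fresh pair and the memory share the local dimension \<open>m\<close>, so that a pair
  can be moved into the memory whole. Both local systems are direct sums of a hidden block of size
  \<open>d\<close> and a pair block; Bob's pair block is doubled to hold the visible bit.\<close>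

definition m :: nat where "m = d ^ K"
definition dA :: nat where "dA = d + m"
definition dB :: nat where "dB = d + 2 * m"

text \<open>\<open>rho z\<close> is a mixture of (unnormalised) pure states: \<open>None\<close> labels the fresh entangled pair, which
lives on the indices from \<open>d\<close> upwards and shows \<open>z\<close> in the parity of Bob's index; \<open>Some (k, l)\<close> labels
\<open>|k l> + |l k>\<close> or \<open>|k l> - |l k>\<close>.\<close>

definition idx :: "(nat \<times> nat) option set" where
  "idx = insert None (Some ` ({..<d} \<times> {..<d}))"

fun amp :: "bool \<Rightarrow> (nat \<times> nat) option \<Rightarrow> nat \<Rightarrow> nat \<Rightarrow> complex" where
  "amp z None a b = (if d \<le> a \<and> b = d + 2 * (a - d) + of_bool z then 1 / sqrt m else 0)"
| "amp z (Some (k, l)) a b = (if a = k \<and> b = l then 1 else 0) + complex_of_real (sg z) * (if a = l \<and> b = k then 1 else 0)"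

text \<open>All ordered pairs \<open>(k, l)\<close> are used, including the diagonal, so the squared
  norms of the hidden vectors add up to \<open>2 * d * (d + sg z)\<close>. Dividing by this gives
  the hidden part trace \<open>1 - p\<close>.\<close>

definition wt :: "bool \<Rightarrow> (nat \<times> nat) option \<Rightarrow> real" where
  "wt z \<kappa> = (case \<kappa> of None \<Rightarrow> p | Some _ \<Rightarrow> (1 - p) / (2 * real d * (real d + sg z)))"

definition rho :: "bool \<Rightarrow> complex mat" where
  "rho z = mix (dA * dB) idx (wt z) (\<lambda>\<kappa> j. amp z \<kappa> (j div dB) (j mod dB))"

lemma m_pos: "0 < m" and dB_pos: "0 < dB"
  using d2 by (simp_all add: m_def dB_def)

lemma sum_idx: "(\<Sum>\<kappa>\<in>idx. f \<kappa>) = f None + (\<Sum>k<d. \<Sum>l<d. f (Some (k, l)))"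
  for f :: "_ \<Rightarrow> 'a::comm_monoid_add"
  by (simp add: idx_def sum.reindex sum.cartesian_product)

lemma wt_nonneg: "0 \<le> wt z \<kappa>"
proof (cases \<kappa>)
  case (Some kl)
  have "0 \<le> 1 - p" "0 \<le> real d + sg z" using d2 p1 by (simp_all add: sg_def)
  thus ?thesis by (simp add: wt_def Some)
qed (use p0 in \<open>simp add: wt_def\<close>)

lemma sum_index_pairs: "(\<Sum>j<dA * dB. f (j div dB) (j mod dB)) = (\<Sum>a<dA. \<Sum>b<dB. f a b)"
  for f :: "nat \<Rightarrow> nat \<Rightarrow> 'a::comm_monoid_add"
  by (simp add: sum_mult_index)

lemma sum_amp_Some:
  fixes f :: "nat \<Rightarrow> nat \<Rightarrow> complex"
  assumes "k < d" "l < d"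
  shows "(\<Sum>a<dA. \<Sum>b<dB. f a b * amp z (Some (k, l)) a b) = f k l + sg z * f l k"
proof -
  have delta: "(\<Sum>a<dA. \<Sum>b<dB. if a = i \<and> b = j then g a b else 0) = g i j" if "i < d" "j < d"
    for i j and g :: "nat \<Rightarrow> nat \<Rightarrow> complex"
  proof -
    have "(\<Sum>a<dA. \<Sum>b<dB. if a = i \<and> b = j then g a b else 0)
      = (\<Sum>a<dA. if a = i then (\<Sum>b<dB. if b = j then g a b else 0) else 0)"
      by (intro sum.cong refl) auto
    thus ?thesis using that by (simp add: dA_def dB_def)
  qed
  have if_lin: "x * ((if P then 1 else 0) + c * (if Q then 1 else 0)) = (if P then x else 0) + (if Q then c * x else 0)"
    for P Q and x c :: complex by (simp add: distrib_left)
  have "f a b * amp z (Some (k, l)) a b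
     = (if a = k \<and> b = l then f a b else 0) + (if a = l \<and> b = k then sg z * f a b else 0)" for a b
    unfolding amp.simps(2) by (rule if_lin)
  hence "(\<Sum>a<dA. \<Sum>b<dB. f a b * amp z (Some (k, l)) a b)
     = (\<Sum>a<dA. \<Sum>b<dB. if a = k \<and> b = l then f a b else 0)
     + (\<Sum>a<dA. \<Sum>b<dB. if a = l \<and> b = k then sg z * f a b else 0)"
    by (simp only: sum.distrib)
  thus ?thesis unfolding delta[OF assms, of f] delta[OF assms(2,1), of "\<lambda>a b. sg z * f a b"] .
qed

lemma sum_amp_None:
  "(\<Sum>a<dA. \<Sum>b<dB. f a b * amp z None a b) = (\<Sum>i<m. f (d + i) (d + 2 * i + of_bool z)) / sqrt m"
proof -
  have "(\<Sum>b<dB. f a b * amp z None a b)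
     = (if d \<le> a then f a (d + 2 * (a - d) + of_bool z) / sqrt m else 0)" if "a < dA" for a
  proof -
    have "(\<Sum>b<dB. f a b * amp z None a b)
       = (\<Sum>b<dB. if b = d + 2 * (a - d) + of_bool z then
            (if d \<le> a then f a (d + 2 * (a - d) + of_bool z) / sqrt m else 0) else 0)"
      by (intro sum.cong refl) auto
    thus ?thesis using that by (auto simp: dA_def dB_def)
  qed
  hence "(\<Sum>a<dA. \<Sum>b<dB. f a b * amp z None a b)
     = (\<Sum>a<dA. if d \<le> a then f a (d + 2 * (a - d) + of_bool z) / sqrt m else 0)"
    by simp
  also have "\<dots> = (\<Sum>a\<in>{d..<dA}. f a (d + 2 * (a - d) + of_bool z) / sqrt m)"
    by (intro sum.mono_neutral_cong_right) auto
  also have "\<dots> = (\<Sum>i<m. f (d + i) (d + 2 * i + of_bool z) / sqrt m)"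
    by (rule sum.reindex_bij_witness[of _ "\<lambda>i. d + i" "\<lambda>a. a - d"]) (auto simp: dA_def)
  finally show ?thesis by (simp add: sum_divide_distrib)
qed

lemma cnj_amp: "cnj (amp z \<kappa> a b) = amp z \<kappa> a b"
proof -
  have "cnj ((if P then 1 else 0) + complex_of_real c * (if Q then 1 else 0))
     = (if P then 1 else 0) + complex_of_real c * (if Q then 1 else 0)" for P Q c by simp
  hence "cnj (amp z (Some (k, l)) a b) = amp z (Some (k, l)) a b" for k l by (simp only: amp.simps(2))
  moreover have "cnj (amp z None a b) = amp z None a b" by simp
  ultimately show ?thesis by (cases \<kappa>) auto
qed

lemma amp_norm:
  "(\<Sum>a<dA. \<Sum>b<dB. (cmod (amp z None a b))\<^sup>2) = 1"
  "k < d \<Longrightarrow> l < d \<Longrightarrow> (\<Sum>a<dA. \<Sum>b<dB. (cmod (amp z (Some (k, l)) a b))\<^sup>2) = 2 + 2 * sg z * of_bool (k = l)"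
proof -
  have c: "complex_of_real (\<Sum>a<dA. \<Sum>b<dB. (cmod (amp z \<kappa> a b))\<^sup>2) = (\<Sum>a<dA. \<Sum>b<dB. amp z \<kappa> a b * amp z \<kappa> a b)" for \<kappa>
    by (simp add: complex_norm_square cnj_amp del: of_real_power)
  have s: "complex_of_real (sqrt (real m)) * complex_of_real (sqrt (real m)) = of_nat m"
    by (simp flip: of_real_mult)
  have "complex_of_real (\<Sum>a<dA. \<Sum>b<dB. (cmod (amp z None a b))\<^sup>2) = 1"
    unfolding c sum_amp_None using m_pos by (simp add: s)
  thus "(\<Sum>a<dA. \<Sum>b<dB. (cmod (amp z None a b))\<^sup>2) = 1" by (simp only: of_real_eq_1_iff)
  assume "k < d" "l < d"
  hence "complex_of_real (\<Sum>a<dA. \<Sum>b<dB. (cmod (amp z (Some (k, l)) a b))\<^sup>2) = of_real (2 + 2 * sg z * of_bool (k = l))"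
    unfolding c by (subst sum_amp_Some; cases z; cases "k = l"; simp add: sg_def)
  thus "(\<Sum>a<dA. \<Sum>b<dB. (cmod (amp z (Some (k, l)) a b))\<^sup>2) = 2 + 2 * sg z * of_bool (k = l)"
    by (simp only: of_real_eq_iff)
qed

lemma amp_swap: "amp z (Some (i, j)) l k = sg z * amp z (Some (i, j)) k l"
proof -
  have "(if Q then 1 else 0) + complex_of_real (sg z) * (if P then 1 else 0) = sg z * ((if P then 1 else 0) + sg z * (if Q then 1 else (0::complex)))" for P Q
    by (simp add: sg_def)
  thus ?thesis unfolding amp.simps(2) conj_commute[of "l = _"] .
qed

text \<open>Three reasons, by component: hidden vectors for different bits are swap eigenvectors
  with opposite eigenvalues, pair vectors differ in the parity of Bob's index, and a hidden and a
  pair vector have disjoint supports.\<close>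

lemma amp_orthogonal:
  assumes "z \<noteq> z'" "\<kappa> \<in> idx" "\<kappa>' \<in> idx"
  shows "(\<Sum>a<dA. \<Sum>b<dB. amp z \<kappa> a b * amp z' \<kappa>' a b) = 0"
proof (cases \<kappa>')
  case None
  have "amp z \<kappa> (d + i) (d + 2 * i + of_bool z') = 0" for i
    using assms by (cases \<kappa>) (auto simp: idx_def of_bool_def split: if_splits)
  thus ?thesis unfolding None sum_amp_None by simp
next
  case (Some kl)
  then obtain k l where kl: "\<kappa>' = Some (k, l)" "k < d" "l < d" using assms by (auto simp: idx_def)
  have s: "complex_of_real (sg z') * complex_of_real (sg z) = - 1"
    using assms(1) by (auto simp: sg_def)
  show ?thesis
  proof (cases \<kappa>)
    case None
    thus ?thesis unfolding kl(1) sum_amp_Some[OF kl(2,3)] using kl(2,3) by simp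
  next
    case (Some ij)
    then obtain i j where ij: "\<kappa> = Some (i, j)" by force
    show ?thesis unfolding kl(1) sum_amp_Some[OF kl(2,3)] ij amp_swap[of z i j l k] mult.assoc[symmetric] s
      by simp
  qed
qed

declare amp.simps [simp del]

lemma amp_norm_index: "(\<Sum>j<dA * dB. (cmod (amp z \<kappa> (j div dB) (j mod dB)))\<^sup>2) = (\<Sum>a<dA. \<Sum>b<dB. (cmod (amp z \<kappa> a b))\<^sup>2)"
  by (rule sum_index_pairs)

lemma rho_carrier: "rho z \<in> carrier_mat (dA * dB) (dA * dB)"
  by (simp add: rho_def)

lemma sum_Some_norm:
  "(\<Sum>k<d. \<Sum>l<d. c * (\<Sum>a<dA. \<Sum>b<dB. (cmod (amp z (Some (k, l)) a b))\<^sup>2)) = c * (2 * real d * (d + sg z))"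
proof -
  have "(\<Sum>k<d. \<Sum>l<d. c * (\<Sum>a<dA. \<Sum>b<dB. (cmod (amp z (Some (k, l)) a b))\<^sup>2))
     = (\<Sum>k<d. \<Sum>l<d. c * (2 + 2 * sg z * of_bool (k = l)))"
    by (intro sum.cong refl) (simp add: amp_norm(2))
  also have "\<dots> = c * (\<Sum>k<d. \<Sum>l<d. 2 + 2 * sg z * of_bool (k = l))"
    by (simp only: sum_distrib_left)
  also have "(\<Sum>k<d. \<Sum>l<d. 2 + 2 * sg z * of_bool (k = l)) = (\<Sum>k<d. 2 * real d + 2 * sg z)"
    by (intro sum.cong refl) (simp add: sum.distrib of_bool_def sum_distrib_left[symmetric])
  also have "\<dots> = 2 * real d * (d + sg z)" by (simp add: algebra_simps)
  finally show ?thesis .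
qed


lemma psd_rho: "psd (rho z)"
  unfolding rho_def by (rule psd_mix) (rule wt_nonneg)

lemma density_rho: "density (dA * dB) (rho z)"
proof -
  have nz: "2 * real d * (real d + sg z) \<noteq> 0" using d2 by (simp add: sg_def)
  have "mtrace (rho z) = of_real (p * 1 + (1 - p) / (2 * real d * (real d + sg z)) * (2 * real d * (real d + sg z)))"
    unfolding rho_def mtrace_mix amp_norm_index sum_idx amp_norm(1) wt_def option.case sum_Some_norm ..
  also have "\<dots> = 1" using nz by (simp only: nonzero_eq_divide_eq[symmetric] times_divide_eq_left nonzero_mult_div_cancel_right) simp
  finally have "mtrace (rho z) = 1" .
  thus ?thesis by (simp add: density_def rho_carrier psd_rho)
qed

lemma rho_orthogonal:
  assumes "z \<noteq> z'"
  shows "rho z * rho z' = 0\<^sub>m (dA * dB) (dA * dB)"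
  unfolding rho_def
proof (rule mix_orthogonal)
  fix k l assume "k \<in> idx" "l \<in> idx"
  thus "(\<Sum>i<dA * dB. cnj (amp z k (i div dB) (i mod dB)) * amp z' l (i div dB) (i mod dB)) = 0"
    using amp_orthogonal[OF assms] sum_index_pairs[where f="\<lambda>a b. amp z k a b * amp z' l a b"]
    by (simp add: cnj_amp)
qed

lemma P_opt_rho: "P_opt (rho False) (rho True) = 1"
proof (rule P_opt_orthogonal[OF rho_carrier rho_carrier density_rho density_rho])
  show "psd (rho False + rho True)"
    by (rule psd_add[OF rho_carrier rho_carrier psd_rho psd_rho])
  show "rho False * rho True = 0\<^sub>m (dA * dB) (dA * dB)" by (rule rho_orthogonal) simp
  show "rho True * rho False = 0\<^sub>m (dA * dB) (dA * dB)" by (rule rho_orthogonal) simp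
qed


text \<open>This is where locality enters the hiding bound: the difference of the two sides is a sum of squares
because the Kraus operator is a product.\<close>

lemma product_amp_sym_ge:
  fixes f g :: "nat \<Rightarrow> nat \<Rightarrow> complex"
  shows "(\<Sum>k<d. \<Sum>l<d. \<Sum>i<r. \<Sum>j<s. (cmod (f i k * g j l - f i l * g j k))\<^sup>2)
    \<le> (\<Sum>k<d. \<Sum>l<d. \<Sum>i<r. \<Sum>j<s. (cmod (f i k * g j l + f i l * g j k))\<^sup>2)"
proof -
  have par: "(cmod (x + y))\<^sup>2 - (cmod (x - y))\<^sup>2 = 4 * Re (x * cnj y)" for x y
    by (simp only: cmod_power2 plus_complex.sel minus_complex.sel times_complex.sel cnj.sel)
      (simp add: power2_eq_square algebra_simps)
  have "(\<Sum>k<d. \<Sum>l<d. \<Sum>i<r. \<Sum>j<s. (cmod (f i k * g j l + f i l * g j k))\<^sup>2)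
     - (\<Sum>k<d. \<Sum>l<d. \<Sum>i<r. \<Sum>j<s. (cmod (f i k * g j l - f i l * g j k))\<^sup>2)
     = (\<Sum>k<d. \<Sum>l<d. \<Sum>i<r. \<Sum>j<s. 4 * Re ((f i k * g j l) * cnj (f i l * g j k)))"
    by (simp only: par sum_subtractf[symmetric])
  also have "\<dots> = (\<Sum>i<r. \<Sum>j<s. \<Sum>k<d. \<Sum>l<d. 4 * Re ((f i k * g j l) * cnj (f i l * g j k)))"
  proof -
    have "(\<Sum>k<d. \<Sum>l<d. \<Sum>i<r. \<Sum>j<s. h k l i j) = (\<Sum>i<r. \<Sum>j<s. \<Sum>k<d. \<Sum>l<d. h k l i j)" for h :: "nat \<Rightarrow> nat \<Rightarrow> nat \<Rightarrow> nat \<Rightarrow> real"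
    proof -
      have "(\<Sum>k<d. \<Sum>l<d. \<Sum>i<r. \<Sum>j<s. h k l i j) = (\<Sum>k<d. \<Sum>i<r. \<Sum>j<s. \<Sum>l<d. h k l i j)"
        by (rule sum.cong[OF refl], subst sum.swap, rule sum.cong[OF refl], rule sum.swap)
      also have "\<dots> = (\<Sum>i<r. \<Sum>j<s. \<Sum>k<d. \<Sum>l<d. h k l i j)"
        by (subst sum.swap, rule sum.cong[OF refl], rule sum.swap)
      finally show ?thesis .
    qed
    thus ?thesis .
  qed
  \<comment> \<open>For a product operator the swap term factors: the sums over \<open>k\<close> and
    \<open>l\<close> are complex conjugates of each other. The total is four times the squared
    Hilbert-Schmidt norm of \<open>f\<close> times the adjoint of \<open>g\<close>.\<close>
  also have "\<dots> = (\<Sum>i<r. \<Sum>j<s. 4 * (cmod (\<Sum>k<d. f i k * cnj (g j k)))\<^sup>2)"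
  proof (intro sum.cong refl)
    fix i j
    have "(\<Sum>k<d. \<Sum>l<d. 4 * Re ((f i k * g j l) * cnj (f i l * g j k)))
       = 4 * Re ((\<Sum>k<d. f i k * cnj (g j k)) * cnj (\<Sum>l<d. f i l * cnj (g j l)))"
      unfolding cnj_sum sum_product by (simp add: sum_distrib_left mult_ac)
    thus "(\<Sum>k<d. \<Sum>l<d. 4 * Re ((f i k * g j l) * cnj (f i l * g j k))) = 4 * (cmod (\<Sum>k<d. f i k * cnj (g j k)))\<^sup>2"
      by (simp only: complex_norm_square[symmetric] Re_complex_of_real)
  qed
  also have "\<dots> \<ge> 0" by (intro sum_nonneg) auto
  finally show ?thesis by simp
qed

text \<open>Arbitrary real weights \<open>w\<close> are allowed so that the formula serves both the
  states and the signed certificate.\<close>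

lemma mtrace_sandwich_mix_amp:
  assumes A: "A \<in> carrier_mat r dA" and B: "B \<in> carrier_mat s dB"
  shows "mtrace (kron A B * mix (dA * dB) idx w (\<lambda>\<kappa> j. amp z \<kappa> (j div dB) (j mod dB)) * cadj (kron A B))
    = of_real (w None * (\<Sum>i<r. \<Sum>j<s. (cmod (\<Sum>a<dA. \<Sum>b<dB. A $$ (i,a) * B $$ (j,b) * amp z None a b))\<^sup>2)
      + (\<Sum>k<d. \<Sum>l<d. w (Some (k, l)) *
         (\<Sum>i<r. \<Sum>j<s. (cmod (A $$ (i,k) * B $$ (j,l) + sg z * (A $$ (i,l) * B $$ (j,k))))\<^sup>2)))"
proof -
  have e: "(\<Sum>j<dA * dB. kron A B $$ (i,j) * amp z \<kappa> (j div dB) (j mod dB))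
     = (\<Sum>a<dA. \<Sum>b<dB. A $$ (i div s,a) * B $$ (i mod s,b) * amp z \<kappa> a b)" if "i < r * s" for i \<kappa>
  proof -
    have "(\<Sum>j<dA * dB. kron A B $$ (i,j) * amp z \<kappa> (j div dB) (j mod dB))
       = (\<Sum>j<dA * dB. A $$ (i div s,j div dB) * B $$ (i mod s,j mod dB) * amp z \<kappa> (j div dB) (j mod dB))"
      using that by (intro sum.cong refl) (simp add: kron_entry[OF A B])
    also have "\<dots> = (\<Sum>a<dA. \<Sum>b<dB. A $$ (i div s,a) * B $$ (i mod s,b) * amp z \<kappa> a b)"
      by (rule sum_index_pairs)
    finally show ?thesis .
  qed
  have n: "(\<Sum>i<r * s. (cmod (\<Sum>j<dA * dB. kron A B $$ (i,j) * amp z \<kappa> (j div dB) (j mod dB)))\<^sup>2)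
    = (\<Sum>i<r. \<Sum>j<s. (cmod (\<Sum>a<dA. \<Sum>b<dB. A $$ (i,a) * B $$ (j,b) * amp z \<kappa> a b))\<^sup>2)" for \<kappa>
  proof -
    have "(\<Sum>i<r * s. (cmod (\<Sum>j<dA * dB. kron A B $$ (i,j) * amp z \<kappa> (j div dB) (j mod dB)))\<^sup>2)
      = (\<Sum>i<r * s. (cmod (\<Sum>a<dA. \<Sum>b<dB. A $$ (i div s,a) * B $$ (i mod s,b) * amp z \<kappa> a b))\<^sup>2)"
      by (intro sum.cong refl) (simp only: e lessThan_iff)
    thus ?thesis by (simp add: sum_mult_index)
  qed
  have "(\<Sum>i<r. \<Sum>j<s. (cmod (\<Sum>a<dA. \<Sum>b<dB. A $$ (i,a) * B $$ (j,b) * amp z (Some (k, l)) a b))\<^sup>2)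
     = (\<Sum>i<r. \<Sum>j<s. (cmod (A $$ (i,k) * B $$ (j,l) + sg z * (A $$ (i,l) * B $$ (j,k))))\<^sup>2)"
    if "k < d" "l < d" for k l
    by (simp only: sum_amp_Some[OF that])
  hence "(\<Sum>k<d. \<Sum>l<d. w (Some (k, l)) *
      (\<Sum>i<r. \<Sum>j<s. (cmod (\<Sum>a<dA. \<Sum>b<dB. A $$ (i,a) * B $$ (j,b) * amp z (Some (k, l)) a b))\<^sup>2))
    = (\<Sum>k<d. \<Sum>l<d. w (Some (k, l)) *
      (\<Sum>i<r. \<Sum>j<s. (cmod (A $$ (i,k) * B $$ (j,l) + sg z * (A $$ (i,l) * B $$ (j,k))))\<^sup>2))"
    by (intro sum.cong refl) (simp only: lessThan_iff)
  thus ?thesis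
    unfolding mix_sandwich[OF kron_carrier[OF A B]] mtrace_mix n sum_idx by (simp only:)
qed

text \<open>The certificate keeps the pair components with weight \<open>p\<close> for both bits. On
  the hidden part it exchanges the two weights and makes the antisymmetric term negative. Its hidden
  trace is \<open>1 - p\<close> times \<open>(d+1)/(d-1) - (d-1)/(d+1)\<close>, which is
  \<open>4 * d / (d^2 - 1)\<close>.\<close>

lemma locc_norm_rho: "locc_norm dA dB (rho False - rho True) \<le> 4 * real d / ((real d)\<^sup>2 - 1) + 2 * p"
proof -
  define h where "h z = (1 - p) / (2 * d * (d + sg z))" for z
  define wT where "wT z \<kappa> = (case \<kappa> of None \<Rightarrow> p | Some _ \<Rightarrow> sg z * h (\<not> z))" for z and \<kappa> :: "(nat \<times> nat) option"
  define T0 where "T0 z = mix (dA * dB) idx (wT z) (\<lambda>\<kappa> j. amp z \<kappa> (j div dB) (j mod dB))" for z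
  have T0: "T0 z \<in> carrier_mat (dA * dB) (dA * dB)" for z by (simp add: T0_def)
  have d: "real d \<ge> 2" using d2 by simp
  have h: "0 \<le> h False" "h False \<le> h True"
    using d p1 by (auto simp: h_def sg_def intro!: divide_left_mono mult_left_mono)
  have "locc_norm dA dB (rho False - rho True) \<le> Re (mtrace (T0 False + T0 True))"
  proof (rule locc_norm_le)
    fix A B :: "complex mat" and af bf assume A: "A \<in> carrier_mat af dA" and B: "B \<in> carrier_mat bf dB"
    note C = kron_carrier[OF A B]
    define F where "F z = (\<Sum>i<af. \<Sum>j<bf. (cmod (\<Sum>a<dA. \<Sum>b<dB. A $$ (i,a) * B $$ (j,b) * amp z None a b))\<^sup>2)" for z
    define H where "H z = (\<Sum>k<d. \<Sum>l<d. \<Sum>i<af. \<Sum>j<bf. (cmod (A $$ (i,k) * B $$ (j,l) + sg z * (A $$ (i,l) * B $$ (j,k))))\<^sup>2)" for z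
    have F: "F z \<ge> 0" for z unfolding F_def by (intro sum_nonneg) auto
    have H0: "H True \<ge> 0" unfolding H_def by (intro sum_nonneg) auto
    have H1: "H True \<le> H False"
      unfolding H_def sg_def using product_amp_sym_ge[of "\<lambda>i k. A $$ (i,k)" "\<lambda>j l. B $$ (j,l)" bf af] by simp
    have R: "mtrace (kron A B * rho z * cadj (kron A B)) = of_real (p * F z + h z * H z)" for z
      unfolding rho_def mtrace_sandwich_mix_amp[OF A B] F_def H_def
      by (simp add: wt_def h_def sum_distrib_left)
    have T: "mtrace (kron A B * T0 z * cadj (kron A B)) = of_real (p * F z + sg z * h (\<not> z) * H z)" for z
      unfolding T0_def mtrace_sandwich_mix_amp[OF A B] F_def H_def
      by (simp add: wT_def sum_distrib_left)
    \<comment> \<open>The two signs of the absolute value amount to the nonnegativity of two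
      products. One uses \<open>h False \<le> h True\<close>, the other
      \<open>H True \<le> H False\<close>, which holds for product operators.\<close>
    have "\<bar>h False * H False - h True * H True\<bar> \<le> h True * H False - h False * H True"
    proof -
      have "0 \<le> (h True - h False) * (H False + H True)" "0 \<le> (h True + h False) * (H False - H True)"
        using h H0 H1 by (auto intro!: mult_nonneg_nonneg)
      thus ?thesis by (simp add: abs_le_iff algebra_simps)
    qed
    moreover have "\<bar>p * F False - p * F True\<bar> \<le> p * F False + p * F True"
      using F p0 by (auto simp: abs_le_iff)
    ultimately have "\<bar>(p * F False + h False * H False) - (p * F True + h True * H True)\<bar>
       \<le> (p * F False + sg False * h True * H False) + (p * F True + sg True * h False * H True)"
      by (simp add: sg_def abs_le_iff)
    thus "cmod (mtrace (kron A B * (rho False - rho True) * cadj (kron A B)))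
        \<le> Re (mtrace (kron A B * (T0 False + T0 True) * cadj (kron A B)))"
      unfolding mtrace_sandwich_linear(1)[OF C T0 T0] mtrace_sandwich_linear(2)[OF C rho_carrier rho_carrier] R T
      by (simp del: of_real_add of_real_mult flip: of_real_diff of_real_add)
  qed (rule minus_carrier_mat[OF rho_carrier] add_carrier_mat[OF T0])+
  also have "Re (mtrace (T0 False + T0 True)) = 4 * real d / ((real d)\<^sup>2 - 1) * (1 - p) + 2 * p"
  proof -
    have "mtrace (T0 z) = of_real (p + sg z * h (\<not> z) * (2 * real d * (real d + sg z)))" for z
    proof -
      show ?thesis
        unfolding T0_def mtrace_mix amp_norm_index sum_idx amp_norm(1) wT_def option.case sum_Some_norm by simp
    qed
    moreover have "h True * (2 * real d * (real d + 1)) - h False * (2 * real d * (real d - 1)) = 4 * real d / ((real d)\<^sup>2 - 1) * (1 - p)"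
    proof -
      have "real d - 1 \<noteq> 0" "real d + 1 \<noteq> 0" "real d \<noteq> 0" "(real d)\<^sup>2 - 1 = (real d - 1) * (real d + 1)"
        using d by (auto simp: algebra_simps power2_eq_square)
      thus ?thesis by (simp add: h_def sg_def divide_simps) (simp add: algebra_simps power2_eq_square)
    qed
    ultimately show ?thesis using mtrace_add[OF T0 T0] d2 by (simp add: sg_def)
  qed
  also have "4 * real d / ((real d)\<^sup>2 - 1) * (1 - p) + 2 * p \<le> 4 * real d / ((real d)\<^sup>2 - 1) + 2 * p"
  proof -
    have "(real d)\<^sup>2 \<ge> 1" using d by simp
    hence "4 * real d / ((real d)\<^sup>2 - 1) * (1 - p) \<le> 4 * real d / ((real d)\<^sup>2 - 1) * 1"
      using p0 p1 by (intro mult_left_mono) auto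
    thus ?thesis by simp
  qed
  finally show ?thesis .
qed

end

section \<open>The teleportation protocol\<close>

lemma sum_roots_of_unity:
  fixes a b d :: nat
  assumes "a < d" "b < d"
  shows "(\<Sum>t<d. cis (2 * pi * t * a / d) * cnj (cis (2 * pi * t * b / d))) = (if a = b then of_nat d else 0)"
proof -
  define x where "x = 2 * pi * (real a - real b) / d"
  have "cis (2 * pi * t * a / d) * cnj (cis (2 * pi * t * b / d)) = cis x ^ t" for t :: nat
    unfolding cis_cnj cis_mult DeMoivre x_def by (rule arg_cong[where f=cis]) (simp add: diff_divide_distrib right_diff_distrib left_diff_distrib mult_ac)
  hence s: "(\<Sum>t<d. cis (2 * pi * t * a / d) * cnj (cis (2 * pi * t * b / d))) = (\<Sum>t<d. cis x ^ t)" by simp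
  show ?thesis
  proof (cases "a = b")
    case True
    thus ?thesis unfolding s by (simp add: x_def)
  next
    case False
    have "cis x \<noteq> 1"
    proof
      assume "cis x = 1"
      hence "cos x = 1" by (metis cis.sel(1) one_complex.sel(1))
      then obtain n :: int where "x = n * 2 * pi" using cos_one_2pi_int by auto
      hence "(2 * pi) * (real a - real b) = (2 * pi) * (n * real d)" using assms(1) by (simp add: x_def field_simps)
      hence "real a - real b = n * real d" by (subst (asm) mult_left_cancel) auto
      hence "int a - int b = n * int d" by (metis of_int_diff of_int_eq_iff of_int_mult of_int_of_nat_eq)
      hence dvd: "int d dvd int a - int b" by simp
      moreover have "\<bar>int a - int b\<bar> < int d" using assms by auto
      moreover have "int a - int b \<noteq> 0" using False by simp
      ultimately show False using dvd_imp_le_int[OF _ dvd] by simp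
    qed
    moreover have "cis x ^ d = 1"
    proof -
      have "cis x ^ d = cis (2 * pi * of_int (int a - int b))" unfolding DeMoivre x_def using assms by simp
      also have "\<dots> = 1" by (rule cis_multiple_2pi) simp
      finally show ?thesis .
    qed
    ultimately show ?thesis unfolding s using False by (simp add: geometric_sum)
  qed
qed

lemma sum_list_product:
  "(\<Sum>x\<leftarrow>List.product xs ys. f x) = (\<Sum>x\<leftarrow>xs. \<Sum>y\<leftarrow>ys. f (x, y))"
  by (induction xs) (simp_all add: comp_def)

lemma add_mod_eq_iff:
  fixes a s r d :: nat
  assumes "a < d" "s < d" "r < d"
  shows "(a + s) mod d = r \<longleftrightarrow> s = (r + d - a) mod d"
proof -
  have 1: "(a + s) mod d = (if a + s < d then a + s else a + s - d)"
    using assms by (auto simp: le_mod_geq)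
  have 2: "(r + d - a) mod d = (if a \<le> r then r - a else r + d - a)"
  proof (cases "a \<le> r")
    case True
    hence "r + d - a = (r - a) + d" by simp
    hence "(r + d - a) mod d = (r - a) mod d" by (simp only: mod_add_self2)
    thus ?thesis using True assms by simp
  qed (use assms in simp)
  show ?thesis unfolding 1 2 using assms by auto
qed

text \<open>A memory index is read in base \<open>d\<close>. Its last digit is the part spent in
  teleportation and \<open>q\<close> holds the remaining digits. For given \<open>a\<close>, every
  index arises from exactly one quotient and one shift.\<close>

lemma shift_index_eq_iff:
  fixes a s q n d :: nat
  assumes "a < d" "s < d"
  shows "n = q * d + (a + s) mod d \<longleftrightarrow> q = n div d \<and> s = (n mod d + d - a) mod d"
proof -
  have "0 < d" using assms by simp
  have "n = q * d + r \<longleftrightarrow> q = n div d \<and> r = n mod d" if "r < d" for r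
    using that by auto
  from this[of "(a + s) mod d"] have "n = q * d + (a + s) mod d \<longleftrightarrow> q = n div d \<and> (a + s) mod d = n mod d"
    using \<open>0 < d\<close> by simp
  thus ?thesis using add_mod_eq_iff[OF assms, of "n mod d"] \<open>0 < d\<close> by simp
qed

lemma sum2_delta:
  fixes f :: "nat \<Rightarrow> nat \<Rightarrow> 'a::comm_monoid_add"
  assumes "i < n" "j < k"
  shows "(\<Sum>a<n. \<Sum>b<k. if b = j \<and> a = i then f a b else 0) = f i j"
proof -
  have "(\<Sum>a<n. \<Sum>b<k. if b = j \<and> a = i then f a b else 0)
    = (\<Sum>a<n. if a = i then (\<Sum>b<k. if b = j then f a b else 0) else 0)"
    by (intro sum.cong refl) auto
  thus ?thesis using assms by simp
qed

context hiding
begin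

definition ph :: "nat \<Rightarrow> nat \<Rightarrow> complex" where
  "ph t a = cis (2 * pi * t * a / d)"

text \<open>Alice's outcome \<open>Inl (s, t)\<close> is the teleportation outcome on a hidden round (\<open>s\<close> the shift, \<open>t\<close> the
phase), \<open>Inr i\<close> reports a fresh pair, the old memory being found in state \<open>i\<close> and discarded; similarly
for Bob, whose outcome also contains the guess. In \<open>kA\<close> and \<open>kB\<close> the index \<open>q\<close> is that of the new memory
and the primed index that of the old one.\<close>

fun kA :: "(nat \<times> nat) + nat \<Rightarrow> nat \<Rightarrow> nat \<Rightarrow> nat \<Rightarrow> complex" where
  "kA (Inl (s, t)) q a a' = (if a < d \<and> a' = q * d + (a + s) mod d then cnj (ph t a) / sqrt d else 0)"
| "kA (Inr i) q a a' = (if a = d + q \<and> a' = i then 1 else 0)"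

text \<open>The bra that finds Alice's teleported system in \<open>k\<close> and Bob's own in
  \<open>l\<close>, the Pauli-type correction for the outcome \<open>st\<close> being built into
  shift and phase. The last memory digit carries the teleported system, and \<open>q\<close>
  survives.\<close>

definition hB :: "nat \<times> nat \<Rightarrow> nat \<Rightarrow> nat \<Rightarrow> nat \<Rightarrow> nat \<Rightarrow> nat \<Rightarrow> complex" where
  "hB st k l q b b' = (if b = l \<and> b' = q * d + (k + fst st) mod d then ph (snd st) k else 0)"

fun kB :: "nat \<times> nat \<Rightarrow> (bool \<times> nat \<times> nat) + (bool \<times> nat) \<Rightarrow> nat \<Rightarrow> nat \<Rightarrow> nat \<Rightarrow> complex" where
  "kB st (Inl (g, k, l)) q b b' = (hB st k l q b b' + complex_of_real (sg g) * hB st l k q b b') / 2"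
| "kB st (Inr (g, j)) q b b' = (if b = d + 2 * q + of_bool g \<and> b' = j then 1 else 0)"

definition outA :: "((nat \<times> nat) + nat) list" where
  "outA = map Inl (List.product [0..<d] [0..<d]) @ map Inr [0..<m]"

definition outB :: "((bool \<times> nat \<times> nat) + (bool \<times> nat)) list" where
  "outB = map Inl (List.product [False, True] (List.product [0..<d] [0..<d])) @ map Inr (List.product [False, True] [0..<m])"

lemma sum_outA: "(\<Sum>x\<leftarrow>outA. f x) = (\<Sum>s<d. \<Sum>t<d. f (Inl (s, t))) + (\<Sum>i<m. f (Inr i))"
  for f :: "_ \<Rightarrow> 'a::comm_monoid_add"
  by (simp add: outA_def sum_list_product comp_def interv_sum_list_conv_sum_set_nat atLeast0LessThan)

lemma sum_outB: "(\<Sum>y\<leftarrow>outB. f y) = (\<Sum>k<d. \<Sum>l<d. f (Inl (False, k, l)) + f (Inl (True, k, l)))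
    + (\<Sum>j<m. f (Inr (False, j)) + f (Inr (True, j)))"
  for f :: "_ \<Rightarrow> 'a::comm_monoid_add"
  by (simp add: outB_def sum_list_product comp_def interv_sum_list_conv_sum_set_nat atLeast0LessThan sum.distrib add_ac)

section \<open>Completeness of the two local measurements\<close>

lemma shift_param:
  assumes "a' < m"
  shows "a' div d < m div d" "(a' mod d + d - a) mod d < d" "a' div d < m" "m = (m div d) * d"
proof -
  have "0 < d" using d2 by simp
  have dvd: "d dvd m" using K1 unfolding m_def by (simp add: dvd_power)
  thus "m = (m div d) * d" by simp
  show "(a' mod d + d - a) mod d < d" using \<open>0 < d\<close> by simp
  show "a' div d < m div d" using assms dvd \<open>0 < d\<close> by (simp add: less_mult_imp_div_less)
  show "a' div d < m" using assms by (meson div_le_dividend order_le_less_trans)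
qed

text \<open>In the hidden block, summing over the phases \<open>t\<close> forces equal indices
  \<open>a\<close>, and the shift and quotient are then determined by \<open>a'\<close>. In the pair
  block, \<open>q\<close> and \<open>i\<close> just read off \<open>a\<close> and
  \<open>a'\<close>.\<close>

lemma kA_complete:
  assumes "a < dA" "a2 < dA" "a' < m" "a2' < m"
  shows "(\<Sum>x\<leftarrow>outA. \<Sum>q<m. cnj (kA x q a a') * kA x q a2 a2') = (if a = a2 \<and> a' = a2' then 1 else 0)"
proof -
  have d0: "0 < d" using d2 by simp
  have sq: "complex_of_real (sqrt (real d)) * complex_of_real (sqrt (real d)) = of_nat d"
    by (simp flip: of_real_mult)
  have "(\<Sum>t<d. \<Sum>q<m. cnj (kA (Inl (s, t)) q a a') * kA (Inl (s, t)) q a2 a2')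
     = (\<Sum>q<m. if q = a' div d \<and> s = (a' mod d + d - a) mod d then (if a = a2 \<and> a < d \<and> a' = a2' then 1 else 0) else 0)"
    (is "?L = ?R") if s: "s < d" for s
  proof -
    have "(\<Sum>t<d. cnj (kA (Inl (s, t)) q a a') * kA (Inl (s, t)) q a2 a2')
      = (if q = a' div d \<and> s = (a' mod d + d - a) mod d then (if a = a2 \<and> a < d \<and> a' = a2' then 1 else 0) else 0)" for q
    proof (cases "a < d \<and> a2 < d")
      case True
      define C where "C = (a' = q * d + (a + s) mod d \<and> a2' = q * d + (a2 + s) mod d)"
      have "(\<Sum>t<d. cnj (kA (Inl (s, t)) q a a') * kA (Inl (s, t)) q a2 a2')
         = (if C then (\<Sum>t<d. ph t a * cnj (ph t a2)) / d else 0)"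
        using True by (simp add: C_def sum_divide_distrib sq)
      also have "(\<Sum>t<d. ph t a * cnj (ph t a2)) = (if a = a2 then of_nat d else 0)"
        unfolding ph_def using True by (intro sum_roots_of_unity) auto
      also have "(if C then (if a = a2 then of_nat d else 0) / of_nat d else (0::complex))
         = (if q = a' div d \<and> s = (a' mod d + d - a) mod d then (if a = a2 \<and> a < d \<and> a' = a2' then 1 else 0) else 0)"
      proof (cases "a = a2")
        case a: True
        have "C \<longleftrightarrow> (q = a' div d \<and> s = (a' mod d + d - a) mod d) \<and> a' = a2'"
          unfolding C_def a[symmetric] using True s shift_index_eq_iff[of a d s a' q] by auto
        thus ?thesis using a True d0 by simp
      qed simp
      finally show ?thesis .
    qed auto
    thus ?thesis by (subst sum.swap) simp
  qed
  hence "(\<Sum>s<d. \<Sum>t<d. \<Sum>q<m. cnj (kA (Inl (s, t)) q a a') * kA (Inl (s, t)) q a2 a2')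
     = (\<Sum>s<d. \<Sum>q<m. if q = a' div d \<and> s = (a' mod d + d - a) mod d then (if a = a2 \<and> a < d \<and> a' = a2' then 1 else 0) else 0)"
    by (intro sum.cong[OF refl]) (simp only: lessThan_iff)
  also have "\<dots> = (if a = a2 \<and> a < d \<and> a' = a2' then 1 else 0)"
    by (rule sum2_delta) (use shift_param[OF assms(3)] in auto)
  finally have 1: "(\<Sum>s<d. \<Sum>t<d. \<Sum>q<m. cnj (kA (Inl (s, t)) q a a') * kA (Inl (s, t)) q a2 a2')
     = (if a = a2 \<and> a < d \<and> a' = a2' then 1 else 0)" .
  have "(\<Sum>i<m. \<Sum>q<m. cnj (kA (Inr i) q a a') * kA (Inr i) q a2 a2') = (if a = a2 \<and> d \<le> a \<and> a' = a2' then 1 else 0)"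
  proof (cases "d \<le> a")
    case True
    have "cnj (kA (Inr i) q a a') * kA (Inr i) q a2 a2' = (if q = a - d \<and> i = a' then (if a = a2 \<and> a' = a2' then 1 else 0) else 0)" for i q
      using True by auto
    hence "(\<Sum>i<m. \<Sum>q<m. cnj (kA (Inr i) q a a') * kA (Inr i) q a2 a2')
      = (\<Sum>i<m. \<Sum>q<m. if q = a - d \<and> i = a' then (if a = a2 \<and> a' = a2' then 1 else 0) else 0)"
      by (simp only:)
    also have "\<dots> = (if a = a2 \<and> a' = a2' then 1 else 0)"
      by (rule sum2_delta) (use assms True in \<open>auto simp: dA_def\<close>)
    finally show ?thesis using True by simp
  qed auto
  with 1 show ?thesis unfolding sum_outA by auto
qed


text \<open>For a fixed correction, \<open>(k, l, q)\<close> is a relabelling of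
  \<open>(b, b')\<close>, and the phases have modulus one.\<close>

lemma hB_complete:
  assumes "b < dB" "b2 < dB" "b' < m" "b2' < m" "fst st < d"
  shows "(\<Sum>k<d. \<Sum>l<d. \<Sum>q<m. cnj (hB st k l q b b') * hB st k l q b2 b2')
    = (if b = b2 \<and> b < d \<and> b' = b2' then 1 else 0)"
proof (cases "b < d")
  case True
  define k0 where "k0 = (b' mod d + d - fst st) mod d"
  have k0: "k0 < d" using d2 by (simp add: k0_def)
  have ph1: "cnj (ph t k) * ph t k = 1" for t k by (simp add: ph_def cis_cnj cis_mult)
  have t: "cnj (hB st k l q b b') * hB st k l q b2 b2'
     = (if q = b' div d \<and> l = b then (if k = k0 then (if b = b2 \<and> b' = b2' then 1 else 0) else 0) else 0)"
    if k: "k < d" for k l q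
  proof -
    have iff: "b' = q * d + (k + fst st) mod d \<longleftrightarrow> q = b' div d \<and> k = k0"
      using shift_index_eq_iff[OF assms(5) k, of b' q] by (simp add: k0_def add.commute)
    show ?thesis
    proof (cases "q = b' div d \<and> k = k0 \<and> l = b")
      case T: True
      with iff have b': "b' = q * d + (k + fst st) mod d" by simp
      have "hB st k l q b b' = ph (snd st) k" using T b' by (simp add: hB_def)
      moreover have "hB st k l q b2 b2' = (if b = b2 \<and> b' = b2' then ph (snd st) k else 0)"
        using T unfolding hB_def b'[symmetric] by (simp add: eq_commute)
      ultimately show ?thesis using T ph1 by simp
    next
      case False
      hence "\<not> (b = l \<and> b' = q * d + (k + fst st) mod d)" using iff by blast
      hence "hB st k l q b b' = 0" unfolding hB_def by (rule if_not_P)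
      thus ?thesis using False by auto
    qed
  qed
  have "(\<Sum>k<d. \<Sum>l<d. \<Sum>q<m. cnj (hB st k l q b b') * hB st k l q b2 b2')
     = (\<Sum>k<d. \<Sum>l<d. \<Sum>q<m. if q = b' div d \<and> l = b then (if k = k0 then (if b = b2 \<and> b' = b2' then 1 else 0) else 0) else 0)"
    by (intro sum.cong[OF refl]) (simp only: t lessThan_iff)
  also have "\<dots> = (\<Sum>k<d. if k = k0 then (if b = b2 \<and> b' = b2' then 1 else 0) else 0)"
    by (intro sum.cong[OF refl] sum2_delta) (use True shift_param[OF assms(3)] in auto)
  also have "\<dots> = (if b = b2 \<and> b' = b2' then 1 else 0)" using k0 by simp
  finally show ?thesis using True by simp
next
  case False
  hence "hB st k l q b b' = 0" if "l < d" for k l q using that by (simp add: hB_def)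
  thus ?thesis using False by simp
qed

lemma kB_complete:
  assumes "b < dB" "b2 < dB" "b' < m" "b2' < m" "fst st < d"
  shows "(\<Sum>y\<leftarrow>outB. \<Sum>q<m. cnj (kB st y q b b') * kB st y q b2 b2') = (if b = b2 \<and> b' = b2' then 1 else 0)"
proof -
  define h where "h k l q = cnj (hB st k l q b b') * hB st k l q b2 b2'" for k l q
  \<comment> \<open>Parallelogram identity. The mean over the two orders of \<open>k\<close> and
    \<open>l\<close> restores the complete family \<open>hB\<close>, which explains the factor 1/2
    in \<open>kB\<close>.\<close>
  have par: "cnj ((x + complex_of_real (sg False) * y) / 2) * ((x2 + complex_of_real (sg False) * y2) / 2)
      + cnj ((x + complex_of_real (sg True) * y) / 2) * ((x2 + complex_of_real (sg True) * y2) / 2)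
      = (cnj x * x2 + cnj y * y2) / 2" for x y x2 y2
    by (simp add: sg_def field_simps)
  have "(\<Sum>k<d. \<Sum>l<d. (\<Sum>q<m. cnj (kB st (Inl (False, k, l)) q b b') * kB st (Inl (False, k, l)) q b2 b2')
       + (\<Sum>q<m. cnj (kB st (Inl (True, k, l)) q b b') * kB st (Inl (True, k, l)) q b2 b2'))
     = (\<Sum>k<d. \<Sum>l<d. \<Sum>q<m. (h k l q + h l k q) / 2)"
    unfolding sum.distrib[symmetric] kB.simps(1) par h_def ..
  also have "\<dots> = ((\<Sum>k<d. \<Sum>l<d. \<Sum>q<m. h k l q) + (\<Sum>k<d. \<Sum>l<d. \<Sum>q<m. h l k q)) / 2"
    by (simp only: sum_divide_distrib[symmetric] sum.distrib)
  also have "(\<Sum>k<d. \<Sum>l<d. \<Sum>q<m. h l k q) = (\<Sum>k<d. \<Sum>l<d. \<Sum>q<m. h k l q)" by (rule sum.swap)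
  finally have 1: "(\<Sum>k<d. \<Sum>l<d. (\<Sum>q<m. cnj (kB st (Inl (False, k, l)) q b b') * kB st (Inl (False, k, l)) q b2 b2')
       + (\<Sum>q<m. cnj (kB st (Inl (True, k, l)) q b b') * kB st (Inl (True, k, l)) q b2 b2'))
     = (if b = b2 \<and> b < d \<and> b' = b2' then 1 else 0)"
    using hB_complete[OF assms] by (simp add: h_def)
  have "(\<Sum>j<m. (\<Sum>q<m. cnj (kB st (Inr (False, j)) q b b') * kB st (Inr (False, j)) q b2 b2')
       + (\<Sum>q<m. cnj (kB st (Inr (True, j)) q b b') * kB st (Inr (True, j)) q b2 b2'))
     = (if b = b2 \<and> d \<le> b \<and> b' = b2' then 1 else 0)"
  proof (cases "d \<le> b")
    case True
    define q0 where "q0 = (b - d) div 2"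
    define g0 where "g0 = odd (b - d)"
    have iff: "b = d + 2 * q + of_bool g \<longleftrightarrow> q = q0 \<and> g = g0" for q g
    proof -
      obtain e where e: "b = d + e" using True by (metis le_add_diff_inverse)
      have "e = 2 * q + of_bool g \<longleftrightarrow> q = e div 2 \<and> g = odd e" by (cases g) (simp_all, presburger+)
      thus ?thesis unfolding q0_def g0_def e by (simp add: add.assoc)
    qed
    have t: "cnj (kB st (Inr (g, j)) q b b') * kB st (Inr (g, j)) q b2 b2'
       = (if q = q0 \<and> j = b' then (if g = g0 then (if b = b2 \<and> b' = b2' then 1 else 0) else 0) else 0)" for q j g
    proof (cases "q = q0 \<and> g = g0 \<and> j = b'")
      case T: True
      hence b: "b = d + 2 * q + of_bool g" using iff by simp
      have "kB st (Inr (g, j)) q b b' = 1" using T b by simp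
      moreover have "kB st (Inr (g, j)) q b2 b2' = (if b = b2 \<and> b' = b2' then 1 else 0)"
        using T unfolding kB.simps(2) b[symmetric] by (simp add: eq_commute)
      ultimately show ?thesis using T by simp
    next
      case False
      hence "\<not> (b = d + 2 * q + of_bool g \<and> b' = j)" using iff by blast
      hence "kB st (Inr (g, j)) q b b' = 0" unfolding kB.simps(2) by (rule if_not_P)
      thus ?thesis using False by auto
    qed
    have s: "(\<Sum>j<m. \<Sum>q<m. cnj (kB st (Inr (g, j)) q b b') * kB st (Inr (g, j)) q b2 b2')
        = (if g = g0 then (if b = b2 \<and> b' = b2' then 1 else 0) else 0)" for g
      unfolding t by (rule sum2_delta) (use assms True in \<open>auto simp: q0_def dB_def\<close>)
    show ?thesis unfolding sum.distrib s using True by (cases g0) auto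
  qed auto
  with 1 show ?thesis unfolding sum_outB by auto
qed

text \<open>The entangled vector of Schmidt rank \<open>d ^ c\<close> sits in the first levels of a
  memory of constant dimension \<open>m\<close>. For \<open>c = 0\<close> it is the product vector
  on index 0, with no entanglement left.\<close>

definition mem :: "nat \<Rightarrow> nat \<Rightarrow> nat \<Rightarrow> complex" where
  "mem c a' b' = (if a' = b' \<and> a' < d ^ c then 1 / sqrt (d ^ c) else 0)"

text \<open>After a fresh-pair report there is nothing to correct; \<open>(0, 0)\<close> is a
  default that still gives Bob a complete measurement.\<close>

definition shift :: "(nat \<times> nat) + nat \<Rightarrow> nat \<times> nat" where
  "shift x = (case x of Inl st \<Rightarrow> st | Inr _ \<Rightarrow> (0, 0))"

text \<open>Truncated subtraction is intended: an exhausted memory stays at level 0.\<close>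

definition nxt :: "(bool \<times> nat \<times> nat) + (bool \<times> nat) \<Rightarrow> nat \<Rightarrow> nat" where
  "nxt y c = (case y of Inl _ \<Rightarrow> c - 1 | Inr _ \<Rightarrow> K)"

text \<open>What the two local Kraus operators become on \<open>AB\<close> once the memory vector is
  inserted: the amplitude from \<open>(a, b)\<close> to the new memory index
  \<open>(q, q')\<close>.\<close>

definition transfer :: "(nat \<times> nat) + nat \<Rightarrow> (bool \<times> nat \<times> nat) + (bool \<times> nat) \<Rightarrow> nat \<Rightarrow> nat \<Rightarrow> nat \<Rightarrow> nat \<Rightarrow> nat \<Rightarrow> complex" where
  "transfer x y c q q' a b = (\<Sum>a'<m. \<Sum>b'<m. kA x q a a' * kB (shift x) y q' b b' * mem c a' b')"

text \<open>Amplitude of the teleportation outcome. For \<open>c > 0\<close> it is independent of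
  \<open>a\<close>, so Alice learns nothing and the swap measurement stays faithful. For
  \<open>c = 0\<close> the shift \<open>s\<close> reveals \<open>a\<close> and coherence is
  lost.\<close>

definition coef :: "nat \<Rightarrow> nat \<Rightarrow> nat \<Rightarrow> complex" where
  "coef c s a = (if c = 0 then (if (a + s) mod d = 0 then 1 / (2 * sqrt d) else 0) else 1 / (2 * d))"

section \<open>Teleportation amplitudes on the memory states\<close>

lemma pow_le_m: "c \<le> K \<Longrightarrow> d ^ c \<le> m"
  using d2 by (simp add: m_def power_increasing)

lemma transfer_eq:
  assumes "c \<le> K"
  shows "transfer x y c q q' a b = (\<Sum>a'<d ^ c. kA x q a a' * kB (shift x) y q' b a') / sqrt (d ^ c)"
proof -
  have "transfer x y c q q' a b = (\<Sum>a'<m. \<Sum>b'<m. if b' = a' then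
      (if a' < d ^ c then kA x q a a' * kB (shift x) y q' b a' / sqrt (d ^ c) else 0) else 0)"
    unfolding transfer_def by (intro sum.cong refl) (auto simp: mem_def)
  also have "\<dots> = (\<Sum>a'<m. if a' < d ^ c then kA x q a a' * kB (shift x) y q' b a' / sqrt (d ^ c) else 0)"
    by simp
  also have "\<dots> = (\<Sum>a'<d ^ c. kA x q a a' * kB (shift x) y q' b a' / sqrt (d ^ c))"
    using pow_le_m[OF assms] by (intro sum.mono_neutral_cong_right) auto
  finally show ?thesis by (simp add: sum_divide_distrib)
qed

lemma index_less_pow_iff:
  assumes "r < d"
  shows "q * d + r < d ^ Suc c \<longleftrightarrow> q < d ^ c"
proof
  assume "q * d + r < d ^ Suc c"
  hence "q * d + r < d ^ c * d" by (simp only: power_Suc mult.commute)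
  hence "q * d < d ^ c * d" by (rule le_less_trans[OF le_add1])
  thus "q < d ^ c" by simp
next
  assume "q < d ^ c"
  from pair_index_less[OF this assms] show "q * d + r < d ^ Suc c" by (simp add: mult.commute)
qed

text \<open>The teleportation identity: Alice's outcome fixes one memory index, Bob's correction
  cancels her phase, and agreement of the base-\<open>d\<close> digits identifies both the
  teleported index and the rest of the memory.\<close>

lemma transfer_Inl_Inl:
  assumes "c \<le> K" "s < d" "k < d" "l < d"
  shows "transfer (Inl (s, t)) (Inl (g, k, l)) c q q' a b = coef c s a * mem (c - 1) q q' * amp g (Some (k, l)) a b"
proof (cases "a < d")
  case False
  hence "amp g (Some (k, l)) a b = 0" using assms by (simp add: amp.simps)
  thus ?thesis using False by (simp add: transfer_eq[OF assms(1)])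
next
  case a: True
  define r where "r = q * d + (a + s) mod d"
  have d0: "0 < d" using d2 by simp
  have sr: "(a + s) mod d < d" using d0 by simp
  have ph1: "cnj (ph t a) * ph t a = 1" by (simp add: ph_def cis_cnj cis_mult)
  have hB: "cnj (ph t a) * hB (s, t) i j q' b r = (if q = q' then (if a = i \<and> b = j then 1 else 0) else 0)" if "i < d" for i j
  proof -
    have "r = q' * d + (i + s) mod d \<longleftrightarrow> q = q' \<and> a = i"
    proof -
      have "r = q' * d + (s + i) mod d \<longleftrightarrow> q' = r div d \<and> i = (r mod d + d - s) mod d"
        by (rule shift_index_eq_iff[OF assms(2) that])
      moreover have "r = q * d + (s + a) mod d \<longleftrightarrow> q = r div d \<and> a = (r mod d + d - s) mod d"
        by (rule shift_index_eq_iff[OF assms(2) a])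
      ultimately show ?thesis by (auto simp: r_def add.commute)
    qed
    thus ?thesis using ph1 unfolding hB_def by auto
  qed
  have "cnj (ph t a) * kB (s, t) (Inl (g, k, l)) q' b r
     = (cnj (ph t a) * hB (s, t) k l q' b r + complex_of_real (sg g) * (cnj (ph t a) * hB (s, t) l k q' b r)) / 2"
    by (simp add: distrib_left mult_ac)
  also have "\<dots> = (if q = q' then amp g (Some (k, l)) a b / 2 else 0)"
    unfolding hB[OF assms(3)] hB[OF assms(4)] amp.simps(2) by (cases "q = q'") simp_all
  finally have kB: "cnj (ph t a) * kB (s, t) (Inl (g, k, l)) q' b r = (if q = q' then amp g (Some (k, l)) a b / 2 else 0)" .
  have "(\<Sum>a'<d ^ c. kA (Inl (s, t)) q a a' * kB (s, t) (Inl (g, k, l)) q' b a')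
     = (\<Sum>a'<d ^ c. if a' = r then cnj (ph t a) * kB (s, t) (Inl (g, k, l)) q' b r / sqrt d else 0)"
    using a by (intro sum.cong refl) (auto simp: r_def)
  also have "\<dots> = (if r < d ^ c then (if q = q' then amp g (Some (k, l)) a b / 2 else 0) / sqrt d else 0)"
    unfolding kB by simp
  finally have e: "transfer (Inl (s, t)) (Inl (g, k, l)) c q q' a b
     = (if r < d ^ c then (if q = q' then amp g (Some (k, l)) a b / 2 else 0) / sqrt d else 0) / sqrt (d ^ c)"
    unfolding transfer_eq[OF assms(1)] by (simp add: shift_def)
  show ?thesis
  proof (cases c)
    \<comment> \<open>Only memory index 0 is occupied, which forces \<open>q = 0\<close> and fixes
      \<open>a\<close> modulo the shift.\<close>
    case 0
    have "r < d ^ c \<longleftrightarrow> q = 0 \<and> (a + s) mod d = 0" using 0 d0 by (auto simp: r_def)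
    thus ?thesis unfolding e using 0 by (auto simp: coef_def mem_def)
  next
    \<comment> \<open>Removing the last digit lowers the exponent by one. The two square roots
      combine to a factor \<open>d\<close> and the normalisation of the smaller memory.\<close>
    case (Suc n)
    have "r < d ^ c \<longleftrightarrow> q < d ^ n" unfolding r_def Suc by (rule index_less_pow_iff[OF sr])
    moreover have "sqrt d * sqrt (d ^ c) = d * sqrt (d ^ n)"
      unfolding Suc by (simp add: real_sqrt_mult)
    hence "complex_of_real (sqrt d) * sqrt (d ^ c) = d * sqrt (d ^ n)" by (metis of_real_mult of_real_of_nat_eq)
    ultimately show ?thesis unfolding e using Suc by (simp add: coef_def mem_def mult.assoc)
  qed
qed

lemma transfer_Inr_Inr:
  assumes "c \<le> K"
  shows "transfer (Inr i) (Inr (g, j)) c q q' a b = (if a = d + q \<and> b = d + 2 * q' + of_bool g then mem c i j else 0)"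
proof -
  have "(\<Sum>a'<d ^ c. kA (Inr i) q a a' * kB (0, 0) (Inr (g, j)) q' b a')
     = (\<Sum>a'<d ^ c. if a' = i then (if a = d + q \<and> b = d + 2 * q' + of_bool g \<and> i = j then 1 else 0) else 0)"
    by (intro sum.cong refl) auto
  thus ?thesis unfolding transfer_eq[OF assms] by (simp add: shift_def mem_def)
qed

text \<open>Reports that disagree about the kind of round are fed only by one party being in the
  hidden block and the other in the pair block, where the states have no amplitude.\<close>

lemma transfer_Inl_Inr: "c \<le> K \<Longrightarrow> \<not> (a < d \<and> d \<le> b) \<Longrightarrow> transfer (Inl st) (Inr gj) c q q' a b = 0"
  by (cases st; cases gj) (auto simp: transfer_eq intro!: sum.neutral)

lemma transfer_Inr_Inl: "c \<le> K \<Longrightarrow> k < d \<Longrightarrow> l < d \<Longrightarrow> \<not> (d \<le> a \<and> b < d) \<Longrightarrow> transfer (Inr i) (Inl (g, k, l)) c q q' a b = 0"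
  by (auto simp: transfer_eq hB_def intro!: sum.neutral)

lemma amp_mixed: "\<kappa> \<in> idx \<Longrightarrow> (a < d) \<noteq> (b < d) \<Longrightarrow> amp z \<kappa> a b = 0"
  by (auto simp: idx_def amp.simps)

text \<open>The scalar left over from component \<open>\<kappa>\<close> when the outcomes are
  \<open>x\<close> and \<open>y\<close>; its squared modulus is the outcome probability of that
  component.\<close>

fun lam :: "(nat \<times> nat) + nat \<Rightarrow> (bool \<times> nat \<times> nat) + (bool \<times> nat) \<Rightarrow> bool \<Rightarrow> nat \<Rightarrow> (nat \<times> nat) option \<Rightarrow> complex" where
  "lam (Inl (s, t)) (Inl (g, k, l)) z c \<kappa> = (\<Sum>a<dA. \<Sum>b<dB. amp z \<kappa> a b * (coef c s a * amp g (Some (k, l)) a b))"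
| "lam (Inr i) (Inr (g, j)) z c \<kappa> = (if \<kappa> = None \<and> z = g then mem c i j else 0)"
| "lam _ _ z c \<kappa> = 0"

text \<open>The new memory vector depends on \<open>y\<close> and \<open>c\<close> but neither on
  \<open>z\<close> nor on \<open>\<kappa>\<close>. This factorisation makes the round a transition
  of the counter.\<close>

lemma amp_transfer:
  assumes "x \<in> set outA" "y \<in> set outB" "\<kappa> \<in> idx" "c \<le> K" "q < m" "q' < m"
  shows "(\<Sum>a<dA. \<Sum>b<dB. amp z \<kappa> a b * transfer x y c q q' a b) = lam x y z c \<kappa> * mem (nxt y c) q q'"
proof (cases x)
  case x: (Inl st)
  obtain s t where st: "st = (s, t)" by force
  have s: "s < d" using assms(1) x st by (auto simp: outA_def)
  show ?thesis
  proof (cases y)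
    case y: (Inl gkl)
    obtain g k l where gkl: "gkl = (g, k, l)" by (cases gkl)
    have kl: "k < d" "l < d" using assms(2) y gkl by (auto simp: outB_def)
    have "amp z \<kappa> a b * (coef c s a * mem (c - 1) q q' * amp g (Some (k, l)) a b)
      = amp z \<kappa> a b * (coef c s a * amp g (Some (k, l)) a b) * mem (c - 1) q q'" for a b
      by (simp only: mult_ac)
    thus ?thesis unfolding x y st gkl transfer_Inl_Inl[OF assms(4) s kl] lam.simps(1) nxt_def sum.case
      by (simp only: sum_distrib_right[symmetric])
  next
    case y: (Inr gj)
    have "amp z \<kappa> a b * transfer x y c q q' a b = 0" for a b
      using transfer_Inl_Inr[OF assms(4), of a b st gj] amp_mixed[OF assms(3), of a b] x y by (cases "a < d \<and> d \<le> b") auto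
    thus ?thesis unfolding x y st by simp
  qed
next
  case x: (Inr i)
  show ?thesis
  proof (cases y)
    case y: (Inl gkl)
    obtain g k l where gkl: "gkl = (g, k, l)" by (cases gkl)
    have kl: "k < d" "l < d" using assms(2) y gkl by (auto simp: outB_def)
    have "amp z \<kappa> a b * transfer x y c q q' a b = 0" for a b
      using transfer_Inr_Inl[OF assms(4) kl, of a b] amp_mixed[OF assms(3), of a b] x y gkl by (cases "d \<le> a \<and> b < d") auto
    thus ?thesis unfolding x y gkl by simp
  next
    case y: (Inr gj)
    obtain g j where gj: "gj = (g, j)" by force
    show ?thesis
    proof (cases \<kappa>)
      case None
      have iff: "(d + i' = d + q \<and> d + 2 * i' + of_bool z = d + 2 * q' + of_bool g) \<longleftrightarrow> i' = q \<and> q = q' \<and> z = g" for i'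
        by (cases z; cases g) (auto, presburger+)
      have "(\<Sum>a<dA. \<Sum>b<dB. amp z None a b * transfer x y c q q' a b)
         = (\<Sum>a<dA. \<Sum>b<dB. transfer x y c q q' a b * amp z None a b)" by (simp only: mult.commute)
      also have "\<dots> = (\<Sum>i'<m. if i' = q then (if q = q' \<and> z = g then mem c i j else 0) else 0) / sqrt m"
        unfolding sum_amp_None x y gj transfer_Inr_Inr[OF assms(4)] iff by (intro arg_cong2[where f="(/)"] sum.cong refl) auto
      also have "\<dots> = (if z = g then mem c i j else 0) * (if q = q' then 1 / complex_of_real (sqrt m) else 0)"
        using assms(5) by simp
      \<comment> \<open>The normalisation of the fresh pair is that of a full memory, since
        \<open>m = d ^ K\<close>.\<close>
      also have "(if q = q' then 1 / complex_of_real (sqrt m) else 0) = mem K q q'"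
        using assms(5) by (simp add: mem_def m_def)
      finally show ?thesis unfolding None x y gj by (simp add: nxt_def)
    next
      case (Some kl)
      then obtain k l where kl: "\<kappa> = Some (k, l)" "k < d" "l < d" using assms(3) by (auto simp: idx_def)
      have "amp z \<kappa> a b * transfer x y c q q' a b = 0" for a b
        unfolding x y gj transfer_Inr_Inr[OF assms(4)] kl(1) using kl(2,3) by (auto simp: amp.simps(2))
      thus ?thesis unfolding x y gj kl(1) by simp
    qed
  qed
qed


section \<open>The protocol as matrices, and one round as a step of the counter\<close>

definition opA :: "(nat \<times> nat) + nat \<Rightarrow> complex mat" where
  "opA x = mat m (dA * m) (\<lambda>(q, j). kA x q (j div m) (j mod m))"

definition opB :: "nat \<times> nat \<Rightarrow> (bool \<times> nat \<times> nat) + (bool \<times> nat) \<Rightarrow> complex mat" where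
  "opB st y = mat m (dB * m) (\<lambda>(q, j). kB st y q (j div m) (j mod m))"

definition answer :: "(bool \<times> nat \<times> nat) + (bool \<times> nat) \<Rightarrow> bool" where
  "answer y = (case y of Inl (g, _) \<Rightarrow> g | Inr (g, _) \<Rightarrow> g)"

definition kraus :: "((nat \<times> nat) + nat) \<times> ((bool \<times> nat \<times> nat) + (bool \<times> nat)) \<Rightarrow> complex mat" where
  "kraus xy = kron (opA (fst xy)) (opB (shift (fst xy)) (snd xy))"

definition outs :: "(((nat \<times> nat) + nat) \<times> ((bool \<times> nat \<times> nat) + (bool \<times> nat))) list" where
  "outs = List.product outA outB"

definition protocol :: "(complex mat \<times> bool) list" where
  "protocol = map (\<lambda>xy. (kraus xy, answer (snd xy))) outs"

lemma opA_carrier: "opA x \<in> carrier_mat m (dA * m)" and opB_carrier: "opB st y \<in> carrier_mat m (dB * m)"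
  by (simp_all add: opA_def opB_def)

lemma opA_entry: "q < m \<Longrightarrow> j < dA * m \<Longrightarrow> opA x $$ (q,j) = kA x q (j div m) (j mod m)"
  and opB_entry: "q < m \<Longrightarrow> j < dB * m \<Longrightarrow> opB st y $$ (q,j) = kB st y q (j div m) (j mod m)"
  by (simp_all add: opA_def opB_def)

lemma kraus_carrier: "kraus xy \<in> carrier_mat (m * m) (dA * m * (dB * m))"
  unfolding kraus_def by (rule kron_carrier[OF opA_carrier opB_carrier])

lemma index_eq_iff: "(i::nat) div m = j div m \<and> i mod m = j mod m \<longleftrightarrow> i = j"
  by (metis div_mult_mod_eq)

lemma shift_less: "x \<in> set outA \<Longrightarrow> fst (shift x) < d"
  using d2 by (auto simp: outA_def shift_def)

lemma locc_protocol: "locc (dA * m) (dB * m) m m protocol"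
proof -
  have product_concat: "map f (List.product xs ys) = concat (map (\<lambda>x. map (\<lambda>y. f (x, y)) ys) xs)" 
    for f :: "'x \<times> 'y \<Rightarrow> 'w" and xs ys by (induction xs) simp_all
  show ?thesis
    unfolding protocol_def outs_def product_concat kraus_def fst_conv snd_conv
  proof (rule locc_two_step[OF opA_carrier opB_carrier])
    fix i j assume ij: "i < dA * m" "j < dA * m"
    note d = div_mod_less_mult[OF ij(1)] div_mod_less_mult[OF ij(2)]
    have "(\<Sum>x\<leftarrow>outA. \<Sum>k<m. cnj (opA x $$ (k,i)) * opA x $$ (k,j))
      = (\<Sum>x\<leftarrow>outA. \<Sum>k<m. cnj (kA x k (i div m) (i mod m)) * kA x k (j div m) (j mod m))"
      by (rule arg_cong[where f=sum_list], rule map_cong[OF refl], rule sum.cong[OF refl]) (simp add: ij opA_entry)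
    thus "(\<Sum>x\<leftarrow>outA. \<Sum>k<m. cnj (opA x $$ (k,i)) * opA x $$ (k,j)) = (if i = j then 1 else 0)"
      unfolding kA_complete[OF d(1,3,2,4)] index_eq_iff .
  next
    fix x i j assume x: "x \<in> set outA" and ij: "i < dB * m" "j < dB * m"
    note d = div_mod_less_mult[OF ij(1)] div_mod_less_mult[OF ij(2)]
    have "(\<Sum>y\<leftarrow>outB. \<Sum>k<m. cnj (opB (shift x) y $$ (k,i)) * opB (shift x) y $$ (k,j))
      = (\<Sum>y\<leftarrow>outB. \<Sum>k<m. cnj (kB (shift x) y k (i div m) (i mod m)) * kB (shift x) y k (j div m) (j mod m))"
      by (rule arg_cong[where f=sum_list], rule map_cong[OF refl], rule sum.cong[OF refl]) (simp add: ij opB_entry)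
    thus "(\<Sum>y\<leftarrow>outB. \<Sum>k<m. cnj (opB (shift x) y $$ (k,i)) * opB (shift x) y $$ (k,j)) = (if i = j then 1 else 0)"
      unfolding kB_complete[OF d(1,3,2,4) shift_less[OF x]] index_eq_iff .
  qed
qed

text \<open>\<open>w\<close> is the accumulated probability of the history, matching the
  unnormalised states that \<open>run\<close> passes on.\<close>

definition mu :: "real \<Rightarrow> nat \<Rightarrow> complex mat" where
  "mu w c = mix (m * m) {()} (\<lambda>_. w) (\<lambda>_ i. mem c (i div m) (i mod m))"

definition prb :: "((nat \<times> nat) + nat) \<times> ((bool \<times> nat \<times> nat) + (bool \<times> nat)) \<Rightarrow> bool \<Rightarrow> nat \<Rightarrow> real" where
  "prb xy z c = (\<Sum>\<kappa>\<in>idx. wt z \<kappa> * (cmod (lam (fst xy) (snd xy) z c \<kappa>))\<^sup>2)"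

definition joint :: "bool \<Rightarrow> nat \<Rightarrow> (nat \<times> nat) option \<Rightarrow> nat \<Rightarrow> complex" where
  "joint z c \<kappa> i =
     amp z \<kappa> (i div (dB * m) div m) (i mod (dB * m) div m) * mem c (i div (dB * m) mod m) (i mod (dB * m) mod m)"

lemma combine_rho_mu: "combine dA dB m m (rho z) (mu w c) = mix (dA * m * (dB * m)) idx (\<lambda>\<kappa>. wt z \<kappa> * w) (joint z c)"
proof -
  have e: "amp z \<kappa> ((i div (dB * m) div m * dB + i mod (dB * m) div m) div dB) ((i div (dB * m) div m * dB + i mod (dB * m) div m) mod dB)
     * mem c ((i div (dB * m) mod m * m + i mod (dB * m) mod m) div m) ((i div (dB * m) mod m * m + i mod (dB * m) mod m) mod m)
     = joint z c \<kappa> i" for i \<kappa>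
  proof -
    have "i mod (dB * m) < dB * m" using dB_pos m_pos by simp
    hence "i mod (dB * m) div m < dB" by (simp add: less_mult_imp_div_less)
    thus ?thesis using m_pos by (simp add: joint_def)
  qed
  show ?thesis unfolding rho_def mu_def combine_mix e ..
qed

lemma pair_index_div_mod: "b < n \<Longrightarrow> (a * n + b) div n = a" "b < n \<Longrightarrow> (a * n + b) mod n = (b::nat)"
  by simp_all

lemma sum_joint_index:
  fixes f :: "nat \<Rightarrow> nat \<Rightarrow> nat \<Rightarrow> nat \<Rightarrow> 'a::comm_monoid_add"
  shows "(\<Sum>j<dA * m * (dB * m). f (j div (dB * m) div m) (j div (dB * m) mod m) (j mod (dB * m) div m) (j mod (dB * m) mod m))
    = (\<Sum>a<dA. \<Sum>b<dB. \<Sum>a'<m. \<Sum>b'<m. f a a' b b')"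
proof -
  have "(\<Sum>j<dA * m * (dB * m). f (j div (dB * m) div m) (j div (dB * m) mod m) (j mod (dB * m) div m) (j mod (dB * m) mod m))
    = (\<Sum>i<dA * m. \<Sum>j<dB * m. f (i div m) (i mod m) (j div m) (j mod m))"
    unfolding sum_mult_index[of _ "dA * m" "dB * m"] by (intro sum.cong refl) (simp only: pair_index_div_mod lessThan_iff)
  also have "\<dots> = (\<Sum>i<dA * m. \<Sum>b<dB. \<Sum>b'<m. f (i div m) (i mod m) b b')"
    unfolding sum_mult_index[of _ dB m] by (intro sum.cong refl) (simp only: pair_index_div_mod lessThan_iff)
  also have "\<dots> = (\<Sum>a<dA. \<Sum>a'<m. \<Sum>b<dB. \<Sum>b'<m. f a a' b b')"
    unfolding sum_mult_index[of _ dA m] by (intro sum.cong refl) (simp only: pair_index_div_mod lessThan_iff)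
  also have "\<dots> = (\<Sum>a<dA. \<Sum>b<dB. \<Sum>a'<m. \<Sum>b'<m. f a a' b b')"
    by (rule sum.cong[OF refl], rule sum.swap)
  finally show ?thesis .
qed

lemma kraus_joint:
  assumes "xy \<in> set outs" "\<kappa> \<in> idx" "c \<le> K" "i < m * m"
  shows "(\<Sum>j<dA * m * (dB * m). kraus xy $$ (i,j) * joint z c \<kappa> j)
    = lam (fst xy) (snd xy) z c \<kappa> * mem (nxt (snd xy) c) (i div m) (i mod m)"
proof -
  obtain x y where xy: "xy = (x, y)" by force
  note d = div_mod_less_mult[OF assms(4)]
  define F where "F a a' b b' = kA x (i div m) a a' * kB (shift x) y (i mod m) b b' * (amp z \<kappa> a b * mem c a' b')" for a a' b b'
  have "(\<Sum>j<dA * m * (dB * m). kraus xy $$ (i,j) * joint z c \<kappa> j)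
    = (\<Sum>j<dA * m * (dB * m). F (j div (dB * m) div m) (j div (dB * m) mod m) (j mod (dB * m) div m) (j mod (dB * m) mod m))"
  proof (rule sum.cong[OF refl])
    fix j assume "j \<in> {..<dA * m * (dB * m)}"
    hence j: "j < dA * m * (dB * m)" by simp
    note e = div_mod_less_mult[OF j]
    show "kraus xy $$ (i,j) * joint z c \<kappa> j
      = F (j div (dB * m) div m) (j div (dB * m) mod m) (j mod (dB * m) div m) (j mod (dB * m) mod m)"
      unfolding kraus_def kron_entry[OF opA_carrier opB_carrier assms(4) j] using d e
      by (simp add: xy F_def joint_def opA_def opB_def)
  qed
  also have "\<dots> = (\<Sum>a<dA. \<Sum>b<dB. \<Sum>a'<m. \<Sum>b'<m. F a a' b b')" by (rule sum_joint_index)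
  also have "\<dots> = (\<Sum>a<dA. \<Sum>b<dB. amp z \<kappa> a b * transfer x y c (i div m) (i mod m) a b)"
    unfolding transfer_def F_def sum_distrib_left by (simp only: mult_ac)
  also have "\<dots> = lam x y z c \<kappa> * mem (nxt y c) (i div m) (i mod m)"
    by (rule amp_transfer) (use assms d xy in \<open>auto simp: outs_def\<close>)
  finally show ?thesis by (simp add: xy)
qed

text \<open>All components leave multiples of one vector, so the post-measurement state collapses to
  a pure memory state. From here on \<open>run\<close> only sees a weight and a counter.\<close>

lemma protocol_step:
  assumes "xy \<in> set outs" "c \<le> K"
  shows "kraus xy * combine dA dB m m (rho z) (mu w c) * cadj (kraus xy) = mu (w * prb xy z c) (nxt (snd xy) c)"
proof -
  have "mix (m * m) idx (\<lambda>\<kappa>. wt z \<kappa> * w) (\<lambda>\<kappa> i. \<Sum>j<dA * m * (dB * m). kraus xy $$ (i,j) * joint z c \<kappa> j)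
     = mix (m * m) {()} (\<lambda>_. \<Sum>\<kappa>\<in>idx. wt z \<kappa> * w * (cmod (lam (fst xy) (snd xy) z c \<kappa>))\<^sup>2)
         (\<lambda>_ i. mem (nxt (snd xy) c) (i div m) (i mod m))"
    by (rule mix_collapse) (rule kraus_joint[OF assms(1) _ assms(2)])
  moreover have "(\<Sum>\<kappa>\<in>idx. wt z \<kappa> * w * (cmod (lam (fst xy) (snd xy) z c \<kappa>))\<^sup>2) = w * prb xy z c"
    unfolding prb_def sum_distrib_left by (simp only: mult_ac)
  ultimately show ?thesis
    unfolding combine_rho_mu mix_sandwich[OF kraus_carrier] by (simp only: mu_def)
qed

section \<open>Outcome probabilities of one round\<close>

lemma mem_norm: "c \<le> K \<Longrightarrow> (\<Sum>a'<m. \<Sum>b'<m. (cmod (mem c a' b'))\<^sup>2) = 1"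
proof -
  assume c: "c \<le> K"
  have "(\<Sum>a'<m. \<Sum>b'<m. (cmod (mem c a' b'))\<^sup>2) = (\<Sum>a'<m. \<Sum>b'<m. if b' = a' then (if a' < d ^ c then 1 / d ^ c else 0) else 0)"
    by (intro sum.cong refl) (auto simp: mem_def norm_divide power_divide)
  also have "\<dots> = (\<Sum>a'<m. if a' < d ^ c then 1 / d ^ c else 0)" by simp
  also have "\<dots> = (\<Sum>a'<d ^ c. 1 / d ^ c)"
    using pow_le_m[OF c] by (intro sum.mono_neutral_cong_right) auto
  also have "\<dots> = 1" using d2 by simp
  finally show ?thesis .
qed

lemma mtrace_mu: "c \<le> K \<Longrightarrow> mtrace (mu w c) = of_real w"
  unfolding mu_def mtrace_mix by (simp add: sum_mult_index mem_norm)

lemma density_mu: "c \<le> K \<Longrightarrow> density (m * m) (mu 1 c)"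
  using mtrace_mu[of c 1] psd_mix[of "{()}" "\<lambda>_. 1"] by (simp add: density_def mu_def)

lemma prb_nonneg: "0 \<le> prb xy z c"
  unfolding prb_def by (intro sum_nonneg mult_nonneg_nonneg wt_nonneg) auto

lemma nxt_le: "c \<le> K \<Longrightarrow> nxt y c \<le> K"
  by (auto simp: nxt_def split: sum.split)

lemma mtrace_combine: "c \<le> K \<Longrightarrow> mtrace (combine dA dB m m (rho z) (mu 1 c)) = 1"
proof -
  assume c: "c \<le> K"
  have "(\<Sum>i<dA * m * (dB * m). (cmod (joint z c \<kappa> i))\<^sup>2) = (\<Sum>j<dA * dB. (cmod (amp z \<kappa> (j div dB) (j mod dB)))\<^sup>2)" for \<kappa>
  proof -
    have "(\<Sum>i<dA * m * (dB * m). (cmod (joint z c \<kappa> i))\<^sup>2)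
      = (\<Sum>a<dA. \<Sum>b<dB. \<Sum>a'<m. \<Sum>b'<m. (cmod (amp z \<kappa> a b * mem c a' b'))\<^sup>2)"
      unfolding joint_def by (rule sum_joint_index)
    also have "\<dots> = (\<Sum>a<dA. \<Sum>b<dB. (cmod (amp z \<kappa> a b))\<^sup>2)"
      by (simp only: norm_mult power_mult_distrib sum_distrib_left[symmetric] mem_norm[OF c] mult_1_right)
    finally show ?thesis unfolding amp_norm_index .
  qed
  hence "mtrace (combine dA dB m m (rho z) (mu 1 c)) = mtrace (rho z)"
    unfolding combine_rho_mu mtrace_mix by (simp add: rho_def mtrace_mix)
  thus ?thesis using density_rho by (simp add: density_def)
qed

text \<open>Read off from trace preservation of the protocol, which avoids summing the squared
  \<open>lam\<close> over all outcomes.\<close>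

lemma sum_prb:
  assumes "c \<le> K"
  shows "(\<Sum>xy\<leftarrow>outs. prb xy z c) = 1"
proof -
  have C: "combine dA dB m m (rho z) (mu 1 c) \<in> carrier_mat (dA * m * (dB * m)) (dA * m * (dB * m))"
    by (simp add: combine_def)
  have "mtrace (kraus xy * combine dA dB m m (rho z) (mu 1 c) * cadj (kraus xy)) = of_real (prb xy z c)"
    if "xy \<in> set outs" for xy
    unfolding protocol_step[OF that assms] mtrace_mu[OF nxt_le[OF assms]] by simp
  hence "(\<Sum>(K, lab)\<leftarrow>protocol. mtrace (K * combine dA dB m m (rho z) (mu 1 c) * cadj K)) = (\<Sum>xy\<leftarrow>outs. of_real (prb xy z c))"
    unfolding protocol_def by (simp add: comp_def cong: map_cong)
  hence "(\<Sum>xy\<leftarrow>outs. complex_of_real (prb xy z c)) = 1"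
    using locc_trace_preserving[OF locc_protocol C] mtrace_combine[OF assms] by simp
  moreover have "(\<Sum>xy\<leftarrow>xs. complex_of_real (f xy)) = of_real (\<Sum>xy\<leftarrow>xs. f xy)" for xs :: "'z list" and f
    by (induction xs) auto
  ultimately show ?thesis by (metis of_real_eq_1_iff)
qed

text \<open>With entanglement left, \<open>coef\<close> is constant, so the amplitude of a wrong
  guess is an inner product of orthogonal vectors. In a fresh-pair round the bit is visible.\<close>

lemma prb_wrong:
  assumes "xy \<in> set outs" "answer (snd xy) \<noteq> z" "c \<noteq> 0 \<or> \<not> isl (snd xy)"
  shows "prb xy z c = 0"
proof -
  obtain x y where xy: "xy = (x, y)" by force
  have "lam x y z c \<kappa> = 0" if \<kappa>: "\<kappa> \<in> idx" for \<kappa>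
  proof (cases y)
    case y: (Inl gkl)
    obtain g k l where gkl: "gkl = (g, k, l)" by (cases gkl)
    have kl: "Some (k, l) \<in> idx" using assms(1) xy y gkl by (auto simp: outs_def outB_def idx_def)
    have c: "c \<noteq> 0" and g: "z \<noteq> g" using assms(2,3) xy y gkl by (auto simp: answer_def)
    show ?thesis
    proof (cases x)
      case (Inl st)
      obtain s t where st: "st = (s, t)" by force
      have "lam x y z c \<kappa> = 1 / (2 * d) * (\<Sum>a<dA. \<Sum>b<dB. amp z \<kappa> a b * amp g (Some (k, l)) a b)"
        unfolding Inl st y gkl lam.simps(1) sum_distrib_left using c by (simp add: coef_def mult_ac)
      thus ?thesis unfolding amp_orthogonal[OF g \<kappa> kl] by simp
    qed (simp add: y gkl)
  next
    case y: (Inr gj)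
    obtain g j where "gj = (g, j)" by force
    thus ?thesis using assms(2) y xy by (cases x) (auto simp: answer_def)
  qed
  thus ?thesis by (simp add: prb_def xy)
qed

text \<open>Summing over the discarded memory results \<open>i\<close> and \<open>j\<close> gives
  the norm of the old memory, so refills occur with probability \<open>p\<close> whatever the
  counter and the bit are.\<close>

lemma sum_prb_Inr:
  assumes "c \<le> K"
  shows "(\<Sum>xy\<leftarrow>outs. prb xy z c * of_bool (\<not> isl (snd xy))) = p"
proof -
  have 0: "prb (Inl st, Inr gj) z c = 0" for st gj by (cases st; cases gj) (simp add: prb_def)
  have "prb (Inr i, Inr (g, j)) z c = (if z = g then p * (cmod (mem c i j))\<^sup>2 else 0)" for i g j
    unfolding prb_def sum_idx by (simp add: wt_def)
  hence 1: "prb (Inr i, Inr (False, j)) z c + prb (Inr i, Inr (True, j)) z c = p * (cmod (mem c i j))\<^sup>2" for i j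
    by (cases z) auto
  have "(\<Sum>xy\<leftarrow>outs. prb xy z c * of_bool (\<not> isl (snd xy))) = (\<Sum>i<m. \<Sum>j<m. prb (Inr i, Inr (False, j)) z c + prb (Inr i, Inr (True, j)) z c)"
    unfolding outs_def sum_list_product sum_outA sum_outB by (simp add: 0)
  also have "\<dots> = p" unfolding 1 sum_distrib_left[symmetric] mem_norm[OF assms] by simp
  finally show ?thesis .
qed

end

section \<open>The achieved rate\<close>

lemma sum_nth_eq_sum_list: "(\<Sum>i<length xs. f (xs ! i)) = (\<Sum>x\<leftarrow>xs. f x)"
  for f :: "'a \<Rightarrow> 'b::comm_monoid_add"
  by (simp add: sum_list_sum_nth atLeast0LessThan)

text \<open>Exponential Markov inequality along the chain: \<open>\<theta> ^ S * V\<close> shrinks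
  by the factor \<open>g\<close> per round in expectation, and \<open>f\<close> is bounded below by
  \<open>1 - \<kappa> * \<theta> ^ s\<close>. The final state is dropped using
  \<open>V \<ge> 1\<close>.\<close>

lemma run_lower_bound:
  fixes mu :: "real \<Rightarrow> nat \<Rightarrow> complex mat" and V :: "nat \<Rightarrow> real" and \<theta> g :: real
  assumes P: "\<And>h. P h = map (\<lambda>o'. (Kr o', ans o')) os"
    and step: "\<And>o' z w c. o' \<in> set os \<Longrightarrow> c \<le> N \<Longrightarrow>
      Kr o' * combine dA dB dA' dB' (if z then \<rho>1 else \<rho>0) (mu w c) * cadj (Kr o') = mu (w * \<pi> o' z c) (nx o' c)"
    and nx: "\<And>o' c. c \<le> N \<Longrightarrow> nx o' c \<le> N"
    and \<pi>: "\<And>o' z c. 0 \<le> \<pi> o' z c" "\<And>z c. c \<le> N \<Longrightarrow> (\<Sum>o'\<leftarrow>os. \<pi> o' z c) = 1"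
    and tr: "\<And>w c. c \<le> N \<Longrightarrow> mtrace (mu w c) = of_real w"
    and drift: "\<And>z c. c \<le> N \<Longrightarrow> (\<Sum>o'\<leftarrow>os. \<pi> o' z c * (\<theta> ^ (if ans o' = z then 1 else 0) * V (nx o' c))) \<le> g * V c"
    and V: "\<And>c. c \<le> N \<Longrightarrow> 1 \<le> V c" and \<theta>: "0 \<le> \<theta>" and g: "0 \<le> g"
  shows "c \<le> N \<Longrightarrow> 0 \<le> w \<Longrightarrow> 0 \<le> \<kappa> \<Longrightarrow> (\<And>s. 1 - \<kappa> * \<theta> ^ s \<le> f s) \<Longrightarrow>
    w * (1 - \<kappa> * g ^ n * V c) \<le> run dA dB dA' dB' \<rho>0 \<rho>1 P n h (mu w c) f"
proof (induction n arbitrary: c w \<kappa> f h)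
  case 0
  have "1 - \<kappa> * V c \<le> 1 - \<kappa> * 1" using mult_left_mono[OF V[OF 0(1)] 0(3)] by simp
  also have "\<dots> \<le> f 0" using 0(4)[of 0] by simp
  finally show ?case using 0(2) tr[OF 0(1)] by (simp add: mult_left_mono)
next
  case (Suc n)
  have half: "w * (1 - \<kappa> * g ^ Suc n * V c) \<le> (\<Sum>i<length (P h).
      run dA dB dA' dB' \<rho>0 \<rho>1 P n (h @ [i])
        (fst (P h ! i) * combine dA dB dA' dB' (if z then \<rho>1 else \<rho>0) (mu w c) * cadj (fst (P h ! i)))
        (\<lambda>s. f (s + (if snd (P h ! i) = z then 1 else 0))))" for z
  proof -
    define G where "G o' = w * \<pi> o' z c * (1 - \<kappa> * \<theta> ^ (if ans o' = z then 1 else 0) * g ^ n * V (nx o' c))" for o'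
    have len: "length (P h) = length os" by (simp add: P)
    have G_le: "G (os ! i) \<le> run dA dB dA' dB' \<rho>0 \<rho>1 P n (h @ [i])
        (fst (P h ! i) * combine dA dB dA' dB' (if z then \<rho>1 else \<rho>0) (mu w c) * cadj (fst (P h ! i)))
        (\<lambda>s. f (s + (if snd (P h ! i) = z then 1 else 0)))" if i: "i < length os" for i
    proof -
      let ?o = "os ! i"
      have Ph: "P h ! i = (Kr ?o, ans ?o)" using i by (simp add: P)
      have o: "?o \<in> set os" using i by simp
      \<comment> \<open>A correct guess is absorbed into the constant by passing from
        \<open>\<kappa>\<close> to \<open>\<kappa> * \<theta>\<close>; hence \<open>\<kappa>\<close>
        and \<open>f\<close> vary in the induction.\<close>
      have "1 - \<kappa> * \<theta> ^ (if ans ?o = z then 1 else 0) * \<theta> ^ s \<le> f (s + (if ans ?o = z then 1 else 0))" for s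
        using Suc.prems(4)[of "s + (if ans ?o = z then 1 else 0)"] by (simp add: mult_ac split: if_splits)
      hence "G ?o \<le> run dA dB dA' dB' \<rho>0 \<rho>1 P n (h @ [i]) (mu (w * \<pi> ?o z c) (nx ?o c)) (\<lambda>s. f (s + (if ans ?o = z then 1 else 0)))"
        unfolding G_def using Suc.prems \<pi>(1) \<theta> by (intro Suc.IH nx) auto
      thus ?thesis unfolding Ph fst_conv snd_conv step[OF o Suc.prems(1)] .
    qed
    have "(\<Sum>i<length os. G (os ! i)) \<le> (\<Sum>i<length (P h).
      run dA dB dA' dB' \<rho>0 \<rho>1 P n (h @ [i])
        (fst (P h ! i) * combine dA dB dA' dB' (if z then \<rho>1 else \<rho>0) (mu w c) * cadj (fst (P h ! i)))
        (\<lambda>s. f (s + (if snd (P h ! i) = z then 1 else 0))))"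
      unfolding len by (rule sum_mono, rule G_le, simp)
    moreover have "w * (1 - \<kappa> * g ^ Suc n * V c) \<le> (\<Sum>i<length os. G (os ! i))"
    proof -
      have "(\<Sum>i<length os. G (os ! i)) = (\<Sum>o'\<leftarrow>os. w * \<pi> o' z c - w * \<kappa> * g ^ n * (\<pi> o' z c * (\<theta> ^ (if ans o' = z then 1 else 0) * V (nx o' c))))"
        unfolding sum_nth_eq_sum_list[where f=G] by (simp add: G_def[abs_def] right_diff_distrib mult_ac)
      also have "\<dots> = w * (\<Sum>o'\<leftarrow>os. \<pi> o' z c) - w * \<kappa> * g ^ n * (\<Sum>o'\<leftarrow>os. \<pi> o' z c * (\<theta> ^ (if ans o' = z then 1 else 0) * V (nx o' c)))"
        by (simp only: sum_list_subtractf sum_list_const_mult)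
      also have "\<dots> \<ge> w * 1 - w * \<kappa> * g ^ n * (g * V c)"
        unfolding \<pi>(2)[OF Suc.prems(1)] using Suc.prems g by (intro diff_mono order_refl mult_left_mono drift) auto
      finally show ?thesis by (simp add: algebra_simps)
    qed
    ultimately show ?thesis by linarith
  qed
  show ?case unfolding run.simps(2) using half[of False] half[of True] by simp
qed

section \<open>Achievable rates are bounded by one, so that the supremum is genuine\<close>

lemma run_zero:
  "(\<And>s. s \<le> n \<Longrightarrow> f s = 0) \<Longrightarrow> run dA dB dA' dB' \<rho>0 \<rho>1 P n h \<sigma> f = 0"
proof (induction n arbitrary: h \<sigma> f)
  case (Suc n)
  have "run dA dB dA' dB' \<rho>0 \<rho>1 P n h' \<sigma>' (\<lambda>s. f (s + (if b then 1 else 0))) = 0" for h' \<sigma>' b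
    by (rule Suc.IH) (use Suc.prems in auto)
  thus ?case by simp
qed simp

lemma achievable_le_one:
  assumes "achievable dA dB dA' dB' \<rho>0 \<rho>1 \<mu> P r"
  shows "r \<le> 1"
proof (rule ccontr)
  assume "\<not> r \<le> 1"
  from assms[unfolded achievable_def, rule_format, of "1/2" 1] obtain n :: nat
    where n: "1 \<le> n" "1 / 2 \<le> prob_rate dA dB dA' dB' \<rho>0 \<rho>1 \<mu> P n r" by auto
  have "real s < r * real n" if "s \<le> n" for s
  proof -
    have "real s \<le> real n * 1" using that by simp
    also have "\<dots> < real n * r" using n(1) \<open>\<not> r \<le> 1\<close> by (intro mult_strict_left_mono) auto
    finally show ?thesis by (simp add: mult.commute)
  qed
  hence "prob_rate dA dB dA' dB' \<rho>0 \<rho>1 \<mu> P n r = 0"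
    unfolding prob_rate_def by (intro run_zero) (auto simp: not_le)
  with n show False by simp
qed

lemma R_m_ge:
  assumes "mem_protocol dA dB dA' dB' \<mu> P" "achievable dA dB dA' dB' \<rho>0 \<rho>1 \<mu> P r"
  shows "r \<le> R_m dA dB \<rho>0 \<rho>1"
  unfolding R_m_def
proof (rule cSup_upper)
  show "bdd_above {r. \<exists>dA' dB' \<mu>1 P. mem_protocol dA dB dA' dB' \<mu>1 P \<and> achievable dA dB dA' dB' \<rho>0 \<rho>1 \<mu>1 P r}"
    by (rule bdd_aboveI[of _ 1]) (auto dest: achievable_le_one)
qed (use assms in blast)

context hiding
begin

lemma mem_protocol_protocol: "mem_protocol dA dB m m (mu 1 K) (\<lambda>_. protocol)"
  using density_mu[of K] locc_protocol by (simp add: mem_protocol_def)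

text \<open>The Lyapunov function is chosen such that one round of the counter chain (reset to \<open>K\<close>
with probability \<open>p\<close>, decrement otherwise) multiplies the expectation of
\<open>(1 + p) ^ (- S)\<close> times \<open>V\<close> by at most \<open>(1 + \<eta>) / (1 + p)\<close>.\<close>

definition V :: "real \<Rightarrow> nat \<Rightarrow> real" where
  "V \<eta> c = 1 + \<eta> / p * (1 / (1 - p)) ^ (K - c)"

lemma V_ge_one: "0 \<le> \<eta> \<Longrightarrow> 1 \<le> V \<eta> c"
  using p0 p1 by (simp add: V_def)

text \<open>Each outcome is bounded by an expression that only asks whether the round was a refill.
  The sum then needs just the total probability and the refill probability \<open>p\<close>.\<close>

lemma drift:
  assumes \<eta>: "0 < \<eta>" and K: "1 / \<eta> \<le> (1 / (1 - p)) ^ K" and c: "c \<le> K"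
  shows "(\<Sum>xy\<leftarrow>outs. prb xy z c * ((1 / (1 + p)) ^ (if answer (snd xy) = z then 1 else 0) * V \<eta> (nxt (snd xy) c)))
     \<le> (1 + \<eta>) / (1 + p) * V \<eta> c"
proof -
  define \<theta> where "\<theta> = 1 / (1 + p)"
  have \<theta>: "0 < \<theta>" "\<theta> * (1 + p) = 1" using p0 by (auto simp: \<theta>_def)
  \<comment> \<open>Charges for a hidden round and for a refill. At \<open>c = 0\<close> a hidden
    round is charged as if the guess were wrong, without the factor \<open>\<theta>\<close>.\<close>
  define bL where "bL = (if c = 0 then V \<eta> 0 else \<theta> * V \<eta> (c - 1))"
  define bR where "bR = \<theta> * V \<eta> K"
  have V0: "0 \<le> V \<eta> c" for c using V_ge_one[of \<eta> c] \<eta> by simp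
  have "prb xy z c * (\<theta> ^ (if answer (snd xy) = z then 1 else 0) * V \<eta> (nxt (snd xy) c))
      \<le> bL * prb xy z c + (bR - bL) * (prb xy z c * of_bool (\<not> isl (snd xy)))" if xy: "xy \<in> set outs" for xy
  proof (cases "c = 0 \<and> isl (snd xy)")
    case True
    have "\<theta> \<le> 1" using p0 by (simp add: \<theta>_def)
    hence "\<theta> ^ (if answer (snd xy) = z then 1 else 0) * V \<eta> (nxt (snd xy) c) \<le> 1 * V \<eta> 0"
      using True V0 by (intro mult_mono) (auto simp: nxt_def isl_def)
    from mult_left_mono[OF this prb_nonneg] show ?thesis using True by (simp add: bL_def mult.commute)
  next
    case False
    show ?thesis
    proof (cases "answer (snd xy) = z")
      case True
      thus ?thesis using False by (cases "snd xy") (auto simp: bL_def bR_def nxt_def algebra_simps)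
    next
      case wrong: False
      have "prb xy z c = 0" by (rule prb_wrong[OF xy wrong]) (use False in auto)
      thus ?thesis by simp
    qed
  qed
  hence "(\<Sum>xy\<leftarrow>outs. prb xy z c * (\<theta> ^ (if answer (snd xy) = z then 1 else 0) * V \<eta> (nxt (snd xy) c)))
     \<le> (\<Sum>xy\<leftarrow>outs. bL * prb xy z c + (bR - bL) * (prb xy z c * of_bool (\<not> isl (snd xy))))"
    by (rule sum_list_mono)
  also have "\<dots> = bL * (1 - p) + bR * p"
    unfolding sum_list_addf sum_list_const_mult sum_prb[OF c] sum_prb_Inr[OF c] by (simp add: algebra_simps)
  also have "\<dots> \<le> \<theta> * ((1 + \<eta>) * V \<eta> c)"
  proof (cases c)
    case 0
    \<comment> \<open>The only place where \<open>K\<close> must be large. With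
      \<open>\<theta> = 1 / (1 + p)\<close> the uncorrected hidden charge costs
      \<open>(1 + p) * (1 - p) = 1 - p * p\<close>, and the slack \<open>p * p * V \<eta> 0\<close>
      has to pay for the refill term \<open>p\<close>.\<close>
    have "1 / p \<le> V \<eta> 0"
    proof -
      have "\<eta> / p * (1 / \<eta>) \<le> \<eta> / p * (1 / (1 - p)) ^ K" using \<eta> p0 K by (intro mult_left_mono) auto
      thus ?thesis using \<eta> by (simp add: V_def)
    qed
    hence "p * p * (1 / p) \<le> p * p * V \<eta> 0" using p0 by (intro mult_left_mono) auto
    hence "p \<le> p * p * V \<eta> 0" using p0 by simp
    moreover have "\<eta> * 1 \<le> \<eta> * V \<eta> 0" using \<eta> V_ge_one[of \<eta> 0] by (intro mult_left_mono) auto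
    moreover have "V \<eta> K * p = p + \<eta>" using p0 by (simp add: V_def algebra_simps)
    ultimately have "(1 + p) * (1 - p) * V \<eta> 0 + V \<eta> K * p \<le> (1 + \<eta>) * V \<eta> 0" by (simp add: algebra_simps)
    hence "\<theta> * ((1 + p) * (1 - p) * V \<eta> 0 + V \<eta> K * p) \<le> \<theta> * ((1 + \<eta>) * V \<eta> 0)" using \<theta> by (intro mult_left_mono) auto
    moreover have "\<theta> * ((1 + p) * (1 - p) * V \<eta> 0 + V \<eta> K * p) = (\<theta> * (1 + p)) * ((1 - p) * V \<eta> 0) + \<theta> * V \<eta> K * p"
      by (simp only: distrib_left mult_ac)
    ultimately show ?thesis using 0 \<theta>(2) by (simp add: bL_def bR_def mult.commute)
  next
    case (Suc n)
    \<comment> \<open>The growth rate \<open>1 / (1 - p)\<close> of \<open>V\<close> cancels the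
      probability of a decrement, and \<open>\<eta> / p\<close> makes the refill add exactly
      \<open>\<eta>\<close>.\<close>
    have "K - n = Suc (K - c)" using Suc c by simp
    hence "(1 / (1 - p)) ^ (K - n) * (1 - p) = (1 / (1 - p)) ^ (K - c)" using p1 by simp
    hence "V \<eta> n * (1 - p) = 1 - p + \<eta> / p * (1 / (1 - p)) ^ (K - c)"
      by (simp only: V_def distrib_right mult.assoc mult_1_left)
    moreover have "V \<eta> K * p = p + \<eta>" using p0 by (simp add: V_def algebra_simps)
    ultimately have "V \<eta> n * (1 - p) + V \<eta> K * p = V \<eta> c + \<eta>" by (simp add: V_def)
    also have "\<dots> \<le> (1 + \<eta>) * V \<eta> c" using \<eta> V_ge_one[of \<eta> c] by (simp add: algebra_simps)
    finally have "\<theta> * (V \<eta> n * (1 - p) + V \<eta> K * p) \<le> \<theta> * ((1 + \<eta>) * V \<eta> c)" using \<theta> by (intro mult_left_mono) auto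
    thus ?thesis using Suc by (simp add: bL_def bR_def algebra_simps)
  qed
  finally show ?thesis by (simp add: \<theta>_def)
qed

text \<open>Chernoff bound: with \<open>\<kappa> = (1 + p) powr (r * n)\<close>, fewer than
  \<open>r * n\<close> correct guesses make \<open>\<kappa> * \<theta> ^ s\<close> at least
  one.\<close>

lemma prob_rate_ge:
  assumes \<eta>: "0 < \<eta>" and K: "1 / \<eta> \<le> (1 / (1 - p)) ^ K"
  shows "1 - ((1 + p) powr r * ((1 + \<eta>) / (1 + p))) ^ n * V \<eta> K
    \<le> prob_rate dA dB m m (rho False) (rho True) (mu 1 K) (\<lambda>_. protocol) n r"
proof -
  define \<kappa> where "\<kappa> = (1 + p) powr (r * n)"
  have f: "1 - \<kappa> * (1 / (1 + p)) ^ s \<le> (if r * n \<le> s then 1 else 0)" for s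
  proof (cases "r * n \<le> s")
    case False
    have "(1 + p) powr (real s) \<le> \<kappa>" unfolding \<kappa>_def using False p0 by (intro powr_mono) auto
    hence "1 \<le> \<kappa> * (1 / (1 + p)) ^ s" using p0 by (simp add: powr_realpow power_divide field_simps)
    thus ?thesis using False by simp
  qed (use p0 in \<open>simp add: \<kappa>_def\<close>)
  have "1 * (1 - \<kappa> * ((1 + \<eta>) / (1 + p)) ^ n * V \<eta> K)
    \<le> run dA dB m m (rho False) (rho True) (\<lambda>_. protocol) n [] (mu 1 K) (\<lambda>s. if r * n \<le> s then 1 else 0)"
  proof (rule run_lower_bound[where Kr=kraus and ans="\<lambda>xy. answer (snd xy)" and os=outs and N=K
        and \<pi>=prb and nx="\<lambda>xy. nxt (snd xy)" and \<theta>="1 / (1 + p)" and mu=mu and V="V \<eta>" and g="(1 + \<eta>) / (1 + p)"])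
    fix xy z w c assume "xy \<in> set outs" "c \<le> K"
    moreover have "(if z then rho True else rho False) = rho z" by simp
    ultimately show "kraus xy * combine dA dB m m (if z then rho True else rho False) (mu w c) * cadj (kraus xy)
        = mu (w * prb xy z c) (nxt (snd xy) c)"
      by (simp only: protocol_step)
  next
    fix z c assume "c \<le> K"
    thus "(\<Sum>xy\<leftarrow>outs. prb xy z c * ((1 / (1 + p)) ^ (if answer (snd xy) = z then 1 else 0) * V \<eta> (nxt (snd xy) c)))
      \<le> (1 + \<eta>) / (1 + p) * V \<eta> c" by (rule drift[OF \<eta> K])
  qed (use f p0 \<eta> in \<open>simp_all add: protocol_def nxt_le prb_nonneg sum_prb mtrace_mu V_ge_one \<kappa>_def\<close>)
  moreover have "\<kappa> = ((1 + p) powr r) ^ n"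
    unfolding \<kappa>_def using p0 by (simp add: powr_powr[symmetric] powr_realpow)
  ultimately show ?thesis by (simp only: prob_rate_def power_mult_distrib mult_1_left)
qed

lemma achievable_protocol:
  assumes \<eta>: "0 < \<eta>" and K: "1 / \<eta> \<le> (1 / (1 - p)) ^ K" and r: "1 + \<eta> < (1 + p) powr (1 - r)"
  shows "achievable dA dB m m (rho False) (rho True) (mu 1 K) (\<lambda>_. protocol) r"
  unfolding achievable_def
proof (intro allI impI)
  fix \<epsilon> :: real and k :: nat assume "0 < \<epsilon>" "0 < k"
  define q where "q = (1 + p) powr r * ((1 + \<eta>) / (1 + p))"
  have pos: "0 < (1 + p) powr r" using p0 by simp
  have q0: "0 \<le> q" using p0 \<eta> pos by (simp add: q_def)
  have "(1 + p) powr r * (1 + \<eta>) < (1 + p) powr r * (1 + p) powr (1 - r)"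
    by (rule mult_strict_left_mono[OF r pos])
  also have "\<dots> = 1 + p" using p0 by (simp add: powr_add[symmetric])
  finally have q1: "q < 1" using p0 by (simp add: q_def)
  have "(\<lambda>n. q ^ n * V \<eta> K) \<longlonglongrightarrow> 0 * V \<eta> K"
    using q0 q1 by (intro tendsto_mult LIMSEQ_power_zero tendsto_const) auto
  hence "\<forall>\<^sub>F n in sequentially. q ^ n * V \<eta> K < \<epsilon>"
    using \<open>0 < \<epsilon>\<close> by (intro order_tendstoD) auto
  then obtain n0 where n0: "\<And>n. n0 \<le> n \<Longrightarrow> q ^ n * V \<eta> K < \<epsilon>" by (auto simp: eventually_sequentially)
  have "1 - \<epsilon> \<le> prob_rate dA dB m m (rho False) (rho True) (mu 1 K) (\<lambda>_. protocol) (max k n0) r"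
    using prob_rate_ge[OF \<eta> K, of r "max k n0"] n0[of "max k n0"] unfolding q_def[symmetric] by simp
  thus "\<exists>n\<ge>k. 1 - \<epsilon> \<le> prob_rate dA dB m m (rho False) (rho True) (mu 1 K) (\<lambda>_. protocol) n r"
    by (intro exI[of _ "max k n0"]) simp
qed

end

theorem theorem2:
  fixes \<epsilon> \<delta> :: real
  assumes "\<epsilon> > 0" and "\<delta> > 0"
  shows "\<exists>dA dB \<rho>0 \<rho>1. density (dA * dB) \<rho>0 \<and> density (dA * dB) \<rho>1 \<and>
           P_opt \<rho>0 \<rho>1 = 1 \<and>
           P_LOCC dA dB \<rho>0 \<rho>1 < 1/2 + \<epsilon> \<and>
           R_m dA dB \<rho>0 \<rho>1 > 1 - \<delta>"
proof -
  \<comment> \<open>The bound \<open>p \<le> \<epsilon>\<close> lets the visible branch use at most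
    half of the allowed LOCC norm \<open>4 * \<epsilon>\<close>; the cap 1/2 keeps
    \<open>p < 1\<close>.\<close>
  define p where "p = min (1/2) \<epsilon>"
  have p: "0 < p" "p < 1" "p \<le> \<epsilon>" using assms by (auto simp: p_def)
  define r where "r = 1 - \<delta> / 2"
  \<comment> \<open>\<open>1 + \<eta>\<close> is the midpoint between 1 and
    \<open>(1 + p) powr (\<delta> / 2)\<close>, as required for geometric decay at rate
    \<open>r\<close>.\<close>
  define \<eta> where "\<eta> = ((1 + p) powr (\<delta> / 2) - 1) / 2"
  have "1 < (1 + p) powr (\<delta> / 2)" using p assms by (intro gr_one_powr) auto
  hence \<eta>: "0 < \<eta>" "1 + \<eta> < (1 + p) powr (1 - r)" by (auto simp: \<eta>_def r_def field_simps)
  obtain K0 :: nat where K0: "1 / \<eta> < (1 / (1 - p)) ^ K0" using real_arch_pow[of "1 / (1 - p)" "1 / \<eta>"] p by auto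
  define K where "K = Suc K0"
  have K: "1 / \<eta> \<le> (1 / (1 - p)) ^ K"
  proof -
    have "(1 / (1 - p)) ^ K0 \<le> (1 / (1 - p)) ^ K" unfolding K_def using p by (intro power_increasing) auto
    thus ?thesis using K0 by simp
  qed
  \<comment> \<open>This makes \<open>8 / d < 2 * \<epsilon>\<close>, the other half of the budget,
    since \<open>4 * d / (d^2 - 1) \<le> 8 / d\<close> for \<open>d \<ge> 2\<close>.\<close>
  obtain d0 :: nat where d0: "4 / \<epsilon> < real d0" using reals_Archimedean2 by blast
  define d where "d = max 2 d0"
  have d: "2 \<le> d" "4 / \<epsilon> < real d" using d0 by (auto simp: d_def)
  interpret hiding d K p by unfold_locales (use d p in \<open>auto simp: K_def\<close>)
  have "locc_norm dA dB (rho False - rho True) < 4 * \<epsilon>"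
  proof -
    have d2: "2 * 2 \<le> real d * real d" using d by (intro mult_mono) auto
    have "4 * real d / ((real d)\<^sup>2 - 1) \<le> 8 / real d"
      using d d2 by (simp add: divide_simps power2_eq_square)
    moreover have "8 / real d < 2 * \<epsilon>" using d assms by (simp add: field_simps)
    ultimately show ?thesis using locc_norm_rho p by linarith
  qed
  hence "P_LOCC dA dB (rho False) (rho True) < 1/2 + \<epsilon>" by (simp add: P_LOCC_def)
  moreover have "r \<le> R_m dA dB (rho False) (rho True)"
    by (rule R_m_ge[OF mem_protocol_protocol achievable_protocol[OF \<eta>(1) K \<eta>(2)]])
  hence "1 - \<delta> < R_m dA dB (rho False) (rho True)" using assms by (simp add: r_def)
  ultimately show ?thesis using density_rho P_opt_rho by blast
qed

end
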